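(* Let $r>0$ be real and $q=e^{-\pi\sqrt r}$. Then $$Q(q)=\frac1\pi K(k_{4r})\sqrt{k_{4r}}=\frac1{2\pi}K(k_r)\,k_r.$$
   Context: $K(x)=\int_0^{\pi/2}\frac{dt}{\sqrt{1-x^2\sin^2 t}}$ for $0\le x<1$. For real $r>0$, $k_r\in(0,1)$ is the unique solution $k$ of $K(\sqrt{1-k^2})/K(k)=\sqrt r$. For $0<q<1$ the continued fraction $Q$ is $$Q(q)=\cfrac{q^{1/2}}{1-q+\cfrac{q(1-q)^2}{(1-q)(q^2+1)+\cfrac{q(1-q^3)^2}{(1-q)(q^4+1)+\cfrac{q(1-q^5)^2}{(1-q)(q^6+1)+\cdots}}}},$$ with the positive square root $q^{1/2}$. *)

theory Defs
  imports "HOL-Analysis.Analysis"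
begin

definition ellK :: "real \<Rightarrow> real" where
  "ellK x = integral {0..pi/2} (\<lambda>t. 1 / sqrt (1 - x\<^sup>2 * (sin t)\<^sup>2))"

definition singular_modulus :: "real \<Rightarrow> real" where
  "singular_modulus r =
     (THE k. 0 < k \<and> k < 1 \<and> ellK (sqrt (1 - k\<^sup>2)) / ellK k = sqrt r)"

(* cf_approx a b m n is the finite continued fraction with n partial quotients
   a m / (b m + a (m+1) / (b (m+1) + ... + a (m+n-1) / b (m+n-1))). *)
primrec cf_approx :: "(nat \<Rightarrow> real) \<Rightarrow> (nat \<Rightarrow> real) \<Rightarrow> nat \<Rightarrow> nat \<Rightarrow> real" where
  "cf_approx a b m 0 = 0"
| "cf_approx a b m (Suc n) = a m / (b m + cf_approx a b (Suc m) n)"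

definition Q_num :: "real \<Rightarrow> nat \<Rightarrow> real" where
  "Q_num q n = (if n = 0 then sqrt q else q * (1 - q ^ (2 * n - 1))\<^sup>2)"

(* The leading partial denominator 1 - q does not follow the pattern
   (1 - q) * (q ^ (2 * n) + 1) of the others. *)
definition Q_den :: "real \<Rightarrow> nat \<Rightarrow> real" where
  "Q_den q n = (if n = 0 then 1 - q else (1 - q) * (q ^ (2 * n) + 1))"

definition Q_approx :: "real \<Rightarrow> nat \<Rightarrow> real" where
  "Q_approx q n = cf_approx (Q_num q) (Q_den q) 0 n"

(* Meaningful only where Q_approx q converges. *)
definition Q_cf :: "real \<Rightarrow> real" where
  "Q_cf q = lim (Q_approx q)"

end

theory Submission
  imports Defs "HOL-Real_Asymp.Real_Asymp"
begin

text \<open>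
  The tails of the continued fraction are ratios of the Lambert-type series
  \<open>S n = (\<Sum>k. q ^ ((2 * n + 1) * k) / (1 + q ^ (2 * k + 1)))\<close>, which satisfy a three-term recurrence;
  hence \<open>Q(q) = sqrt q * S 0\<close>.

  With \<open>q = exp (- h)\<close>, let \<open>A h\<close> and \<open>C h\<close> be the sums of \<open>1 / cosh (n h)\<close> over all integers and
  over all half-integers \<open>n\<close>, so that \<open>C h = 4 sqrt q * S 0\<close>. Splitting by parity gives
  \<open>A h = A (2 h) + C (2 h)\<close>. Multiplying out \<open>(C h)\<^sup>2\<close> and \<open>A (2 h) * C (2 h)\<close>, the products with a
  fixed index difference telescope through \<open>tanh\<close>, and one finds \<open>(C h)\<^sup>2 = 4 A (2 h) C (2 h)\<close>.
  Therefore \<open>k h = C h / A h\<close> satisfies \<open>k h = 2 sqrt l / (1 + l)\<close> with \<open>l = k (2 h)\<close>, which is a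
  Landen transformation of \<open>K\<close>. So \<open>K (k h) / A h\<close> and \<open>K' (k h) / (h * K (k h))\<close> are invariant
  under \<open>h \<mapsto> 2 h\<close> and equal their limits \<open>\<pi> / 2\<close> and \<open>1 / \<pi>\<close> at infinity. In particular
  \<open>k (\<pi> sqrt r)\<close> is the singular modulus \<open>k\<^sub>r\<close>.
\<close>

section \<open>The continued fraction\<close>

definition lamb :: "real \<Rightarrow> nat \<Rightarrow> real" where
  "lamb q n = (\<Sum>k. q ^ ((2 * n + 1) * k) / (1 + q ^ (2 * k + 1)))"

context
  fixes q :: real
  assumes q0: "0 < q" and q1: "q < 1"
begin

lemma odd_power_less_one: "q ^ (2 * n + 1) < 1"
  using q0 q1 by (simp add: power_less_one_iff del: power_Suc)

lemma lamb_summable: "summable (\<lambda>k. q ^ ((2 * n + 1) * k) / (1 + q ^ (2 * k + 1)))"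
proof (rule summable_comparison_test')
  show "summable (\<lambda>k. q ^ k)" using q0 q1 by (simp add: summable_geometric)
  fix k :: nat
  have a: "q ^ ((2 * n + 1) * k) \<le> q ^ k"
    using q0 q1 by (intro power_decreasing) auto
  have b: "q ^ ((2 * n + 1) * k) \<le> q ^ ((2 * n + 1) * k) * (1 + q ^ (2 * k + 1))"
    using q0 by (simp add: distrib_left)
  have c: "1 + q ^ (2 * k + 1) > 0" using q0 by (simp add: add_pos_pos)
  have "q ^ ((2 * n + 1) * k) / (1 + q ^ (2 * k + 1)) \<le> q ^ ((2 * n + 1) * k)"
    using b c by (simp only: pos_divide_le_eq)
  moreover have "q ^ ((2 * n + 1) * k) / (1 + q ^ (2 * k + 1)) \<ge> 0" using q0 c by simp
  ultimately show "norm (q ^ ((2 * n + 1) * k) / (1 + q ^ (2 * k + 1))) \<le> q ^ k"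
    using a by (simp only: real_norm_def abs_of_nonneg)
qed

lemma lamb_sums: "(\<lambda>k. q ^ ((2 * n + 1) * k) / (1 + q ^ (2 * k + 1))) sums lamb q n"
  unfolding lamb_def using lamb_summable by (rule summable_sums)

lemma lamb_pos: "lamb q n > 0"
  unfolding lamb_def
proof (rule suminf_pos[OF lamb_summable])
  fix k :: nat
  show "0 < q ^ ((2 * n + 1) * k) / (1 + q ^ (2 * k + 1))"
    using q0 by (intro divide_pos_pos add_pos_pos) auto
qed

lemma lamb_Suc_le: "lamb q (Suc n) \<le> lamb q n"
  unfolding lamb_def
proof (rule suminf_le[OF _ lamb_summable lamb_summable])
  fix k :: nat
  show "q ^ ((2 * Suc n + 1) * k) / (1 + q ^ (2 * k + 1)) \<le> q ^ ((2 * n + 1) * k) / (1 + q ^ (2 * k + 1))"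
    using q0 q1 by (intro divide_right_mono power_decreasing) auto
qed

text \<open>The \<open>k\<close>-th terms add up to \<open>q ^ k * (1 + q ^ (2 * k + 1))\<close>
  over the common denominator, so a geometric series remains. This handles the leading partial
  denominator \<open>1 - q\<close>, which is off the pattern of the others.\<close>

lemma lamb_0_1: "(1 - q) * (lamb q 0 + q * lamb q 1) = 1"
proof -
  have "(\<lambda>k. q ^ ((2 * 0 + 1) * k) / (1 + q ^ (2 * k + 1)) + q * (q ^ ((2 * 1 + 1) * k) / (1 + q ^ (2 * k + 1))))
      sums (lamb q 0 + q * lamb q 1)"
    by (intro sums_add sums_mult lamb_sums)
  moreover have "q ^ ((2 * 0 + 1) * k) / (1 + q ^ (2 * k + 1)) + q * (q ^ ((2 * 1 + 1) * k) / (1 + q ^ (2 * k + 1))) = q ^ k" for k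
  proof -
    have c: "1 + q ^ (2 * k + 1) > 0" using q0 by (simp add: add_pos_pos)
    have "q ^ ((2 * 1 + 1) * k) = q ^ k * q ^ (2 * k)"
      by (simp flip: power_add)
    hence "q ^ ((2 * 0 + 1) * k) / (1 + q ^ (2 * k + 1)) + q * (q ^ ((2 * 1 + 1) * k) / (1 + q ^ (2 * k + 1)))
        = q ^ k * (1 + q ^ (2 * k + 1)) / (1 + q ^ (2 * k + 1))"
      by (simp add: add_divide_distrib distrib_left)
    also have "\<dots> = q ^ k" using c by (simp only: nonzero_mult_div_cancel_right[OF less_imp_neq[THEN not_sym]])
    finally show ?thesis .
  qed
  ultimately have "(\<lambda>k. q ^ k) sums (lamb q 0 + q * lamb q 1)" by simp
  moreover have "(\<lambda>k. q ^ k) sums (1 / (1 - q))" using q0 q1 by (intro geometric_sums) auto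
  ultimately have "lamb q 0 + q * lamb q 1 = 1 / (1 - q)" by (rule sums_unique2)
  thus ?thesis using q1 by simp
qed

text \<open>The difference of the two sides is a telescoping series.\<close>
lemma lamb_rec:
  "(1 - q ^ (2 * n + 1)) * lamb q n =
     (1 - q) * (1 + q ^ (2 * n + 2)) * lamb q (n + 1) + q * (1 - q ^ (2 * n + 3)) * lamb q (n + 2)"
proof -
  define t where "t k = q ^ ((2 * n + 1) * k) / (1 + q ^ (2 * k + 1))" for k
  \<comment> \<open>The numerator of the combined \<open>k\<close>-th terms is divisible by
    \<open>1 + q ^ (2 * k + 1)\<close>, and the quotient is a difference of this sequence. It
    vanishes at \<open>k = 0\<close> and at infinity, so the telescoping sum is 0.\<close>
  define s where "s k = - (q ^ ((2 * n + 1) * k)) * (1 - q ^ (2 * k))" for k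
  have e: "(1 - q ^ (2 * n + 1)) * (q ^ ((2 * n + 1) * k) / (1 + q ^ (2 * k + 1)))
      - (1 - q) * (1 + q ^ (2 * n + 2)) * (q ^ ((2 * (n + 1) + 1) * k) / (1 + q ^ (2 * k + 1)))
      - q * (1 - q ^ (2 * n + 3)) * (q ^ ((2 * (n + 2) + 1) * k) / (1 + q ^ (2 * k + 1)))
     = s (Suc k) - s k" (is "?l = _") for k
  proof -
    define a b c where "a = q ^ ((2 * n + 1) * k)" and "b = q ^ (2 * k)" and "c = q ^ (2 * n + 1)"
    have p: "q ^ ((2 * n + 1) * k) = a" "q ^ (2 * k + 1) = q * b" "q ^ ((2 * (n + 1) + 1) * k) = a * b"
       "q ^ ((2 * (n + 2) + 1) * k) = a * b * b" "q ^ (2 * n + 2) = q * c" "q ^ (2 * n + 3) = q\<^sup>2 * c"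
       "q ^ (2 * n + 1) = c" "q ^ ((2 * n + 1) * Suc k) = a * c" "q ^ (2 * Suc k) = q\<^sup>2 * b" "q ^ (2 * k) = b"
      by (simp_all add: a_def b_def c_def algebra_simps power2_eq_square power3_eq_cube flip: power_add)
         (simp_all add: power_add power2_eq_square numeral_eq_Suc)
    have d: "1 + q * b > 0" using q0 unfolding b_def by (intro add_pos_pos) auto
    have "?l = (a * ((1 - c) - (1 - q) * (1 + q * c) * b - q * (1 - q\<^sup>2 * c) * b * b)) / (1 + q * b)"
      unfolding p by (simp add: diff_divide_distrib add_divide_distrib algebra_simps)
    also have "(a * ((1 - c) - (1 - q) * (1 + q * c) * b - q * (1 - q\<^sup>2 * c) * b * b))
       = (a * (1 - b) - a * c * (1 - q\<^sup>2 * b)) * (1 + q * b)"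
      by algebra
    also have "\<dots> / (1 + q * b) = a * (1 - b) - a * c * (1 - q\<^sup>2 * b)" using d by simp
    also have "\<dots> = s (Suc k) - s k" unfolding s_def p by simp
    finally show ?thesis .
  qed
  have "s \<longlonglongrightarrow> 0"
  proof -
    have i: "(\<lambda>k. q ^ ((2 * n + 1) * k)) \<longlonglongrightarrow> 0" "(\<lambda>k. q ^ (2 * k)) \<longlonglongrightarrow> 0"
      unfolding power_mult using q0 q1 odd_power_less_one[of n]
      by (auto intro!: LIMSEQ_power_zero simp: abs_square_less_1 simp del: power_Suc)
    have "(\<lambda>k. - (q ^ ((2 * n + 1) * k)) * (1 - q ^ (2 * k))) \<longlonglongrightarrow> - 0 * (1 - 0)"
      by (intro tendsto_intros i)
    thus ?thesis by (simp add: s_def[abs_def])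
  qed
  hence "(\<lambda>k. s (Suc k) - s k) sums (0 - s 0)" by (rule telescope_sums)
  hence s: "(\<lambda>k. s (Suc k) - s k) sums 0" by (simp add: s_def)
  have "(\<lambda>k. (1 - q ^ (2 * n + 1)) * (q ^ ((2 * n + 1) * k) / (1 + q ^ (2 * k + 1)))
      - (1 - q) * (1 + q ^ (2 * n + 2)) * (q ^ ((2 * (n + 1) + 1) * k) / (1 + q ^ (2 * k + 1)))
      - q * (1 - q ^ (2 * n + 3)) * (q ^ ((2 * (n + 2) + 1) * k) / (1 + q ^ (2 * k + 1)))) sums
     ((1 - q ^ (2 * n + 1)) * lamb q n -
     (1 - q) * (1 + q ^ (2 * n + 2)) * lamb q (n + 1) - q * (1 - q ^ (2 * n + 3)) * lamb q (n + 2))"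
    by (intro sums_diff sums_mult lamb_sums)
  hence "(1 - q ^ (2 * n + 1)) * lamb q n -
     (1 - q) * (1 + q ^ (2 * n + 2)) * lamb q (n + 1) - q * (1 - q ^ (2 * n + 3)) * lamb q (n + 2) = 0"
    unfolding e using s by (rule sums_unique2)
  thus ?thesis by simp
qed

section \<open>Tails of the continued fraction and convergence of the approximants\<close>

text \<open>\<open>cf_tail n\<close> is the tail that starts at index \<open>Suc n\<close>.\<close>
definition cf_tail :: "nat \<Rightarrow> real" where
  "cf_tail n = q * (1 - q ^ (2 * n + 1)) * lamb q (n + 1) / lamb q n"

lemma tail_pos: "cf_tail n > 0"
  unfolding cf_tail_def using q0 odd_power_less_one[of n] lamb_pos
  by (intro divide_pos_pos mult_pos_pos) auto

lemma tail_le: "cf_tail n \<le> q * (1 - q ^ (2 * n + 1))"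
  unfolding cf_tail_def using q0 odd_power_less_one[of n] lamb_pos[of n] lamb_Suc_le[of n]
  by (simp add: pos_divide_le_eq mult_left_mono)

lemma Q_num_pos: "Q_num q n > 0"
  using q0 odd_power_less_one[of "n - 1"] by (cases n) (auto simp: Q_num_def)

lemma Q_den_ge: "Q_den q n \<ge> 1 - q"
  using q0 q1 by (auto simp: Q_den_def algebra_simps)

text \<open>Dividing \<open>lamb_rec\<close> by \<open>lamb q (n + 1)\<close> turns it into one
  level of the continued fraction. This alone does not make the approximants converge to the tails;
  the error estimates below do.\<close>

lemma tail_rec: "cf_tail n = Q_num q (Suc n) / (Q_den q (Suc n) + cf_tail (Suc n))"
proof -
  define u where "u = 1 - q ^ (2 * n + 1)"
  have u: "u > 0" using odd_power_less_one[of n] by (simp add: u_def)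
  have a: "Q_num q (Suc n) = q * u\<^sup>2" by (simp add: Q_num_def u_def)
  have b: "Q_den q (Suc n) = (1 - q) * (1 + q ^ (2 * n + 2))" by (simp add: Q_den_def)
  have "(Q_den q (Suc n) + cf_tail (Suc n)) * lamb q (Suc n) = u * lamb q n"
    using lamb_rec[of n] lamb_pos[of "Suc n"] unfolding b u_def cf_tail_def
    by (simp add: distrib_right add.commute eval_nat_numeral)
  hence "Q_den q (Suc n) + cf_tail (Suc n) = u * lamb q n / lamb q (Suc n)"
    using lamb_pos[of "Suc n"] by (simp add: eq_divide_eq)
  moreover have "cf_tail n = q * u * lamb q (Suc n) / lamb q n" by (simp add: cf_tail_def u_def)
  ultimately show ?thesis unfolding a using u lamb_pos[of n] lamb_pos[of "Suc n"]
    by (simp add: power2_eq_square)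
qed

lemma cf_nonneg: "cf_approx (Q_num q) (Q_den q) m n \<ge> 0"
proof (induction n arbitrary: m)
  case (Suc n)
  show ?case using Q_num_pos[of m] Q_den_ge[of m] Suc[of "Suc m"] q1 by simp
qed simp

text \<open>Two levels are unfolded at once. The errors then differ by the exact factor
  \<open>x0 * x1 / (b0 * (b1 + c) + a1)\<close>, which is at most \<open>q\<close> because
  \<open>tail_le\<close> gives \<open>x0 * x1 \<le> q * a1\<close>.\<close>

lemma cf_err_step:
  "\<bar>cf_approx (Q_num q) (Q_den q) (Suc m) (Suc (Suc n)) - cf_tail m\<bar>
     \<le> q * \<bar>cf_approx (Q_num q) (Q_den q) (Suc (Suc (Suc m))) n - cf_tail (Suc (Suc m))\<bar>"
proof -
  define c where "c = cf_approx (Q_num q) (Q_den q) (Suc (Suc (Suc m))) n"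
  define x0 x1 x2 where "x0 = cf_tail m" and "x1 = cf_tail (Suc m)" and "x2 = cf_tail (Suc (Suc m))"
  define a0 a1 b0 b1 where "a0 = Q_num q (Suc m)" and "a1 = Q_num q (Suc (Suc m))"
    and "b0 = Q_den q (Suc m)" and "b1 = Q_den q (Suc (Suc m))"
  have x0: "x0 = a0 / (b0 + x1)" and x1: "x1 = a1 / (b1 + x2)"
    unfolding x0_def x1_def x2_def a0_def a1_def b0_def b1_def by (rule tail_rec)+
  have pos: "a0 > 0" "a1 > 0" "b0 > 0" "b1 > 0" "x0 > 0" "x1 > 0" "x2 > 0" "c \<ge> 0"
    unfolding x0_def x1_def x2_def a0_def a1_def b0_def b1_def c_def
    using Q_num_pos Q_den_ge[of "Suc m"] Q_den_ge[of "Suc (Suc m)"] q1 tail_pos cf_nonneg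
    by (auto intro: less_le_trans[of 0 "1-q"])
  have xx: "x0 * x1 \<le> q * a1"
  proof -
    have "x0 * x1 \<le> (q * (1 - q ^ (2 * m + 1))) * (q * (1 - q ^ (2 * Suc m + 1)))"
      unfolding x0_def x1_def using tail_pos[of m] tail_pos[of "Suc m"]
      by (intro mult_mono tail_le) (auto simp: q0 order_less_imp_le intro!: mult_nonneg_nonneg order_less_imp_le[OF odd_power_less_one, simplified])
    also have "\<dots> \<le> (q * (1 - q ^ (2 * Suc m + 1))) * (q * (1 - q ^ (2 * Suc m + 1)))"
    proof (intro mult_right_mono mult_left_mono diff_left_mono)
      show "q ^ (2 * Suc m + 1) \<le> q ^ (2 * m + 1)" using q0 q1 by (intro power_decreasing) auto
    qed (use q0 odd_power_less_one[of "Suc m"] in auto)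
    also have "\<dots> = q * a1" by (simp add: a1_def Q_num_def power2_eq_square algebra_simps)
    finally show ?thesis .
  qed
  \<comment> \<open>\<open>w\<close> approximates \<open>x1\<close> as \<open>c\<close> approximates
    \<open>x2\<close>; each level multiplies the error by an explicit quotient.\<close>
  define w where "w = a1 / (b1 + c)"
  have w: "w \<ge> 0" using pos by (simp add: w_def)
  have "a0 / (b0 + w) - x0 = x0 * (x1 - w) / (b0 + w)"
  proof -
    have "a0 = x0 * (b0 + x1)" using x0 pos by simp
    thus ?thesis using pos w by (simp add: field_simps)
  qed
  also have "x1 - w = x1 * (c - x2) / (b1 + c)"
  proof -
    have "a1 = x1 * (b1 + x2)" using x1 pos by simp
    thus ?thesis using pos by (simp add: w_def field_simps)
  qed
  also have "x0 * (x1 * (c - x2) / (b1 + c)) / (b0 + w) = (x0 * x1) / (b0 * (b1 + c) + a1) * (c - x2)"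
  proof -
    have "(b0 + w) * (b1 + c) = b0 * (b1 + c) + a1" using pos by (simp add: w_def field_simps)
    thus ?thesis by (simp add: mult.commute mult.left_commute)
  qed
  finally have "\<bar>a0 / (b0 + w) - x0\<bar> = (x0 * x1) / (b0 * (b1 + c) + a1) * \<bar>c - x2\<bar>"
    using pos by (simp add: abs_mult)
  also have "\<dots> \<le> q * \<bar>c - x2\<bar>"
  proof (rule mult_right_mono)
    have "x0 * x1 \<le> q * (b0 * (b1 + c) + a1)"
      using xx pos q0 by (simp add: distrib_left add_increasing)
    moreover have "b0 * (b1 + c) + a1 > 0" using pos by (intro add_nonneg_pos) auto
    ultimately show "(x0 * x1) / (b0 * (b1 + c) + a1) \<le> q" by (simp add: pos_divide_le_eq)
  qed simp
  finally show ?thesis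
    by (simp add: w_def c_def x0_def x1_def x2_def a0_def a1_def b0_def b1_def)
qed

text \<open>Induction in steps of two. The constant covers both base cases: for \<open>n = 0\<close>
  the error is the tail itself, at most 1, and for \<open>n = 1\<close> the approximant is at most
  \<open>1 / (1 - q)\<close>.\<close>

lemma cf_err:
  "\<bar>cf_approx (Q_num q) (Q_den q) (Suc m) n - cf_tail m\<bar> \<le> q ^ (n div 2) * (1 / (1 - q) + 1)"
proof (induction n arbitrary: m rule: less_induct)
  case (less n)
  have t: "cf_tail m \<ge> 0" "cf_tail m \<le> 1"
    using tail_pos[of m] tail_le[of m] q0 q1 mult_mono[of q 1 "1 - q ^ (2*m+1)" 1] odd_power_less_one[of m]
    by auto
  have i: "1 / (1 - q) > 0" using q1 by simp
  consider "n = 0" | "n = 1" | k where "n = Suc (Suc k)" by (metis One_nat_def not0_implies_Suc)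
  thus ?case
  proof cases
    case 1 thus ?thesis using t i by (simp del: zero_less_divide_1_iff)
  next
    case 2
    have "Q_num q (Suc m) \<le> 1"
      unfolding Q_num_def using q0 q1 odd_power_less_one[of m] by (auto intro!: mult_le_one power_le_one)
    hence "Q_num q (Suc m) / Q_den q (Suc m) \<le> 1 / (1 - q)"
      using Q_den_ge[of "Suc m"] q1 by (intro frac_le) auto
    moreover have "Q_num q (Suc m) / Q_den q (Suc m) \<ge> 0"
      using Q_num_pos[of "Suc m"] Q_den_ge[of "Suc m"] q1 by (intro divide_nonneg_nonneg) auto
    ultimately show ?thesis using 2 t i by simp
  next
    case 3
    have "\<bar>cf_approx (Q_num q) (Q_den q) (Suc m) n - cf_tail m\<bar> \<le> q * (q ^ (k div 2) * (1 / (1 - q) + 1))"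
      unfolding 3 using q0
      by (intro order.trans[OF cf_err_step] mult_left_mono less.IH) (auto simp: 3)
    thus ?thesis by (simp add: 3)
  qed
qed

lemma Q_approx_tendsto: "Q_approx q \<longlonglongrightarrow> sqrt q * lamb q 0"
proof -
  have "filterlim (\<lambda>n::nat. n div 2) at_top sequentially"
    by (rule filterlim_at_top_div_const_nat) simp
  hence "(\<lambda>n. q ^ (n div 2)) \<longlonglongrightarrow> 0"
    using q0 q1 by (intro filterlim_compose[OF LIMSEQ_power_zero]) auto
  hence z: "(\<lambda>n. q ^ (n div 2) * (1 / (1 - q) + 1)) \<longlonglongrightarrow> 0"
    by (rule tendsto_mult_left_zero)
  have "(\<lambda>n. cf_approx (Q_num q) (Q_den q) (Suc 0) n - cf_tail 0) \<longlonglongrightarrow> 0"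
    by (rule tendsto_rabs_zero_cancel, rule tendsto_sandwich[OF _ _ tendsto_const z])
       (simp_all add: cf_err del: cf_approx.simps)
  hence "(\<lambda>n. cf_approx (Q_num q) (Q_den q) (Suc 0) n) \<longlonglongrightarrow> cf_tail 0"
    by (rule LIM_zero_cancel)
  hence "(\<lambda>n. sqrt q / ((1 - q) + cf_approx (Q_num q) (Q_den q) (Suc 0) n)) \<longlonglongrightarrow> sqrt q / ((1 - q) + cf_tail 0)"
    using tail_pos[of 0] q1 by (intro tendsto_intros) auto
  \<comment> \<open>By the definition of \<open>cf_tail 0\<close>, this is \<open>lamb_0_1\<close>
    divided by \<open>lamb q 0\<close>.\<close>
  also have "sqrt q / ((1 - q) + cf_tail 0) = sqrt q * lamb q 0"
  proof -
    have "((1 - q) + cf_tail 0) * lamb q 0 = 1"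
    proof -
      have "cf_tail 0 * lamb q 0 = q * (1 - q) * lamb q 1"
        using lamb_pos[of 0] by (simp add: cf_tail_def)
      thus ?thesis using lamb_0_1 by (simp add: distrib_right) (simp add: algebra_simps)
    qed
    moreover have "(1 - q) + cf_tail 0 > 0" using tail_pos[of 0] q1 by simp
    ultimately have "lamb q 0 = 1 / ((1 - q) + cf_tail 0)" by (simp add: eq_divide_eq mult.commute)
    thus ?thesis by simp
  qed
  finally have "(\<lambda>n. Q_approx q (Suc n)) \<longlonglongrightarrow> sqrt q * lamb q 0"
    by (simp add: Q_approx_def Q_num_def[of _ 0] Q_den_def[of _ 0])
  thus ?thesis by (rule LIMSEQ_imp_Suc)
qed

end

section \<open>Landen's transformation and the period ratio\<close>

lemma modulus_sin_less_1:
  fixes k t :: real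
  assumes "0 \<le> k" "k < 1"
  shows "k\<^sup>2 * (sin t)\<^sup>2 < 1"
proof -
  have "k\<^sup>2 * (sin t)\<^sup>2 \<le> k\<^sup>2 * 1"
    by (intro mult_left_mono) (auto simp: abs_square_le_1)
  also have "\<dots> < 1" using assms by (simp add: power_less_one_iff)
  finally show ?thesis .
qed

lemma continuous_on_ellK_integrand [continuous_intros]:
  fixes k :: real
  assumes "0 \<le> k" "k < 1"
  shows "continuous_on A (\<lambda>t. 1 / sqrt (1 - k\<^sup>2 * (sin t)\<^sup>2))"
  using modulus_sin_less_1[OF assms]
  by (intro continuous_intros) (auto simp: less_le)

lemma ellK_has_integral:
  assumes "0 \<le> k" "k < 1"
  shows "((\<lambda>t. 1 / sqrt (1 - k\<^sup>2 * (sin t)\<^sup>2)) has_integral ellK k) {0..pi/2}"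
  unfolding ellK_def using assms
  by (intro integrable_integral integrable_continuous_real continuous_intros)

lemma ellK_strict_mono:
  assumes "0 \<le> a" "a < b" "b < 1"
  shows "ellK a < ellK b"
  unfolding ellK_def
proof (rule integral_less_real)
  fix t :: real assume t: "t \<in> {0<..<pi/2}"
  have "sin t > 0" using t by (intro sin_gt_zero) auto
  hence "a\<^sup>2 * (sin t)\<^sup>2 < b\<^sup>2 * (sin t)\<^sup>2"
    using assms by (intro mult_strict_right_mono power_strict_mono) auto
  thus "1 / sqrt (1 - a\<^sup>2 * (sin t)\<^sup>2) < 1 / sqrt (1 - b\<^sup>2 * (sin t)\<^sup>2)"
    using modulus_sin_less_1[of b t] assms by (intro divide_strict_left_mono) auto
next
  show "{0<..<pi / 2} \<noteq> {}" using dense[OF pi_half_gt_zero] by auto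
qed (use assms in \<open>auto intro!: continuous_intros\<close>)

lemma ellK_0: "ellK 0 = pi / 2"
  by (simp add: ellK_def)

lemma ellK_ge:
  assumes "0 \<le> k" "k < 1"
  shows "pi / 2 \<le> ellK k"
  using ellK_strict_mono[of 0 k] assms ellK_0 by (cases "k = 0") auto

lemma ellK_pos:
  assumes "0 \<le> k" "k < 1"
  shows "0 < ellK k"
  using ellK_ge[OF assms] pi_gt_zero by linarith

lemma ellK_le:
  assumes "0 \<le> k" "k < 1"
  shows "ellK k \<le> pi / 2 / sqrt (1 - k\<^sup>2)"
proof -
  have "ellK k \<le> integral {0..pi/2} (\<lambda>t. 1 / sqrt (1 - k\<^sup>2))"
    unfolding ellK_def
  proof (rule integral_le)
    fix t :: real
    have "k\<^sup>2 * (sin t)\<^sup>2 \<le> k\<^sup>2 * 1"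
      by (intro mult_left_mono) (auto simp: abs_square_le_1)
    moreover have "k\<^sup>2 < 1" using assms by (simp add: power_less_one_iff)
    ultimately show "1 / sqrt (1 - k\<^sup>2 * (sin t)\<^sup>2) \<le> 1 / sqrt (1 - k\<^sup>2)"
      by (intro divide_left_mono) auto
  qed (use assms in \<open>auto intro!: integrable_continuous_real continuous_intros\<close>)
  thus ?thesis by simp
qed

lemma tendsto_ellK_0:
  assumes "(k \<longlongrightarrow> 0) F" "eventually (\<lambda>x. 0 \<le> k x \<and> k x < 1) F"
  shows "((\<lambda>x. ellK (k x)) \<longlongrightarrow> pi / 2) F"
proof (rule tendsto_sandwich[of "\<lambda>_. pi / 2"])
  have "((\<lambda>x. pi / 2 / sqrt (1 - (k x)\<^sup>2)) \<longlongrightarrow> pi / 2 / sqrt (1 - 0\<^sup>2)) F"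
    by (intro tendsto_intros assms) auto
  thus "((\<lambda>x. pi / 2 / sqrt (1 - (k x)\<^sup>2)) \<longlongrightarrow> pi / 2) F" by simp
qed (use assms(2) in \<open>auto elim!: eventually_mono intro: ellK_ge[simplified] ellK_le[simplified]\<close>)

text \<open>Gauss's substitution \<open>sin t = (1 + l) sin s / (1 + l sin\<^sup>2 s)\<close>.\<close>
lemma ellK_landen:
  assumes l: "0 \<le> l" "l < 1"
  shows "ellK (2 * sqrt l / (1 + l)) = (1 + l) * ellK l"
proof -
  define k where "k = 2 * sqrt l / (1 + l)"
  define u where "u s = (1 + l) * sin s / (1 + l * (sin s)\<^sup>2)" for s
  define f where "f t = 1 / sqrt (1 - k\<^sup>2 * (sin t)\<^sup>2)" for t
  define g' where "g' s = (1 + l) * (1 - l * (sin s)\<^sup>2) / ((1 + l * (sin s)\<^sup>2) * sqrt (1 - l\<^sup>2 * (sin s)\<^sup>2))" for s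
  have k2: "k\<^sup>2 = 4 * l / (1 + l)\<^sup>2" using l by (simp add: k_def power_divide power_mult_distrib)
  have "4 * l < (1 + l)\<^sup>2"
  proof -
    have "(1 + l)\<^sup>2 - 4 * l = (1 - l)\<^sup>2" by algebra
    moreover have "(1 - l)\<^sup>2 > 0" using l by simp
    ultimately show ?thesis by linarith
  qed
  hence "k\<^sup>2 < 1" using l by (simp add: k2)
  moreover have k0: "0 \<le> k" using l by (simp add: k_def)
  ultimately have k: "0 \<le> k" "k < 1" by (auto simp: abs_square_less_1)
  have D: "1 + l * (sin s)\<^sup>2 > 0" for s using l by (intro add_pos_nonneg) auto
  have R: "1 - l\<^sup>2 * (sin s)\<^sup>2 > 0" for s using modulus_sin_less_1[OF l, of s] by simp
  have N: "1 - l * (sin s)\<^sup>2 > 0" for s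
  proof -
    have "l * (sin s)\<^sup>2 \<le> l * 1" using l by (intro mult_left_mono) (auto simp: abs_square_le_1)
    thus ?thesis using l by linarith
  qed
  \<comment> \<open>This factorization shows that \<open>u\<close> stays within the domain of
    \<open>arcsin\<close> and supplies the root in the derivative of \<open>arcsin (u s)\<close>,
    which is \<open>g' s\<close>.\<close>
  have u2: "1 - (u s)\<^sup>2 = (cos s)\<^sup>2 * (1 - l\<^sup>2 * (sin s)\<^sup>2) / (1 + l * (sin s)\<^sup>2)\<^sup>2" for s
  proof -
    have "1 - (u s)\<^sup>2 = ((1 + l * (sin s)\<^sup>2)\<^sup>2 - ((1 + l) * sin s)\<^sup>2) / (1 + l * (sin s)\<^sup>2)\<^sup>2"
      using D[of s] by (simp add: u_def power_divide diff_divide_distrib)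
    also have "(1 + l * (sin s)\<^sup>2)\<^sup>2 - ((1 + l) * sin s)\<^sup>2 = (1 - (sin s)\<^sup>2) * (1 - l\<^sup>2 * (sin s)\<^sup>2)"
      by algebra
    finally show ?thesis by (simp add: cos_squared_eq)
  qed
  have sin_range: "-1 \<le> u s" "u s \<le> 1" for s
  proof -
    have "1 - (u s)\<^sup>2 \<ge> 0" unfolding u2 using R[of s] by simp
    hence "\<bar>u s\<bar> \<le> 1" by (simp add: abs_square_le_1)
    thus "-1 \<le> u s" "u s \<le> 1" by auto
  qed
  have ucont: "continuous_on A u" for A
    unfolding u_def[abs_def] using D by (intro continuous_intros) (auto simp: less_le)
  have sub: "((\<lambda>s. g' s *\<^sub>R f (arcsin (u s))) has_integral
       (integral {arcsin (u 0)..arcsin (u (pi/2))} f)) {0..pi/2}"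
  \<comment> \<open>The end point \<open>pi / 2\<close> is exempted from differentiability: there
    \<open>u\<close> equals 1, where \<open>arcsin\<close> has no derivative.\<close>
  proof (rule has_integral_substitution_strong[where s = "{pi/2}" and c = 0 and d = "pi/2"])
    have u0: "0 \<le> u s" if "s \<in> {0..pi/2}" for s
      using that l D[of s] by (auto simp: u_def intro!: divide_nonneg_pos mult_nonneg_nonneg sin_ge_zero)
    show "(\<lambda>s. arcsin (u s)) ` {0..pi / 2} \<subseteq> {0..pi / 2}"
      using u0 sin_range by (auto intro!: arcsin_ubound[simplified] arcsin_nonneg)
    show "arcsin (u 0) \<le> arcsin (u (pi / 2))"
      using l sin_range by (intro arcsin_le_arcsin) (auto simp: u_def)
    show "continuous_on {0..pi / 2} f"
      unfolding f_def[abs_def] by (intro continuous_intros k)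
    show "continuous_on {0..pi / 2} (\<lambda>s. arcsin (u s))"
      using sin_range by (intro continuous_on_arcsin ucont) auto
    fix s assume s: "s \<in> {0..pi/2} - {pi/2}"
    have c: "cos s > 0" using s by (intro cos_gt_zero_pi) auto
    have "1 - (u s)\<^sup>2 > 0" unfolding u2 using c R[of s] D[of s] by simp
    hence u1: "-1 < u s" "u s < 1" by (auto simp: abs_square_less_1 abs_less_iff)
    have sq: "sqrt (1 - (u s)\<^sup>2) = cos s * sqrt (1 - l\<^sup>2 * (sin s)\<^sup>2) / (1 + l * (sin s)\<^sup>2)"
      unfolding u2 using c D[of s] by (simp add: real_sqrt_divide real_sqrt_mult)
    have du: "(u has_field_derivative (1 + l) * cos s * (1 - l * (sin s)\<^sup>2) / (1 + l * (sin s)\<^sup>2)\<^sup>2) (at s)"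
      unfolding u_def[abs_def] using D[of s]
      by (auto intro!: derivative_eq_intros simp: power2_eq_square algebra_simps)
    have "((\<lambda>s. arcsin (u s)) has_field_derivative
        (1 + l) * cos s * (1 - l * (sin s)\<^sup>2) / (1 + l * (sin s)\<^sup>2)\<^sup>2 / sqrt (1 - (u s)\<^sup>2)) (at s)"
      using DERIV_chain2[OF DERIV_arcsin[OF u1] du] by (simp add: field_simps)
    also have "(1 + l) * cos s * (1 - l * (sin s)\<^sup>2) / (1 + l * (sin s)\<^sup>2)\<^sup>2 / sqrt (1 - (u s)\<^sup>2) = g' s"
      unfolding sq g'_def using c D[of s] R[of s] by (simp add: divide_simps power2_eq_square)
    finally show "((\<lambda>s. arcsin (u s)) has_field_derivative g' s) (at s within {0..pi / 2})"
      by (rule has_field_derivative_at_within)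
  qed auto
  have ends: "arcsin (u 0) = 0" "arcsin (u (pi/2)) = pi/2" using l by (auto simp: u_def)
  \<comment> \<open>Here \<open>1 - k\<^sup>2 * (u s)\<^sup>2\<close> is a perfect square, so its
    root is rational in \<open>sin s\<close> and cancels against \<open>g' s\<close>.\<close>
  have "g' s *\<^sub>R f (arcsin (u s)) = (1 + l) * (1 / sqrt (1 - l\<^sup>2 * (sin s)\<^sup>2))" for s
  proof -
    have "1 - k\<^sup>2 * (u s)\<^sup>2 = ((1 + l * (sin s)\<^sup>2)\<^sup>2 - 4 * l * (sin s)\<^sup>2) / (1 + l * (sin s)\<^sup>2)\<^sup>2"
      using D[of s] l by (simp add: k2 u_def power_divide power_mult_distrib diff_divide_distrib)
    also have "(1 + l * (sin s)\<^sup>2)\<^sup>2 - 4 * l * (sin s)\<^sup>2 = (1 - l * (sin s)\<^sup>2)\<^sup>2" by algebra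
    finally have "sqrt (1 - k\<^sup>2 * (u s)\<^sup>2) = (1 - l * (sin s)\<^sup>2) / (1 + l * (sin s)\<^sup>2)"
      using N[of s] D[of s] by (simp add: real_sqrt_divide)
    thus ?thesis using sin_range N[of s] D[of s] R[of s] by (simp add: f_def g'_def)
  qed
  hence "((\<lambda>s. (1 + l) * (1 / sqrt (1 - l\<^sup>2 * (sin s)\<^sup>2))) has_integral ellK k) {0..pi/2}"
    using sub by (simp add: ends ellK_def f_def[abs_def])
  moreover have "((\<lambda>s. (1 + l) * (1 / sqrt (1 - l\<^sup>2 * (sin s)\<^sup>2))) has_integral (1 + l) * ellK l) {0..pi/2}"
    by (intro has_integral_mult_right ellK_has_integral l)
  ultimately show ?thesis unfolding k_def by (rule has_integral_unique)
qed

section \<open>The ratio K'/K and the singular modulus\<close>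

definition period_ratio :: "real \<Rightarrow> real" where
  "period_ratio k = ellK (sqrt (1 - k\<^sup>2)) / ellK k"

text \<open>Landen's transformation acts twice: it carries \<open>l\<close> to \<open>k\<close>, and
  the complement \<open>m\<close> of \<open>k\<close> to the complement of \<open>l\<close>. The
  factors \<open>1 + l\<close> and \<open>1 + m = 2 / (1 + l)\<close> combine to 2.\<close>

lemma period_ratio_landen:
  assumes l: "0 < l" "l < 1"
  shows "period_ratio l = 2 * period_ratio (2 * sqrt l / (1 + l))"
proof -
  define k where "k = 2 * sqrt l / (1 + l)"
  define m where "m = (1 - l) / (1 + l)"
  have m: "0 \<le> m" "m < 1" using l by (auto simp: m_def)
  have k2: "k\<^sup>2 = 4 * l / (1 + l)\<^sup>2" using l by (simp add: k_def power_divide power_mult_distrib)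
  have "1 - k\<^sup>2 = ((1 + l)\<^sup>2 - 4 * l) / (1 + l)\<^sup>2" using l by (simp add: k2 diff_divide_distrib)
  also have "(1 + l)\<^sup>2 - 4 * l = (1 - l)\<^sup>2" by algebra
  finally have km: "sqrt (1 - k\<^sup>2) = m" using l by (simp add: m_def real_sqrt_divide)
  have m1: "1 + m = 2 / (1 + l)" using l by (simp add: m_def field_simps)
  have "2 * sqrt m / (1 + m) = sqrt m * (1 + l)" unfolding m1 using l by simp
  also have "\<dots> = sqrt (m * (1 + l)\<^sup>2)" using l by (simp add: real_sqrt_mult)
  also have "m * (1 + l)\<^sup>2 = 1 - l\<^sup>2" using l by (simp add: m_def power2_eq_square field_simps)
  finally have "ellK (sqrt (1 - l\<^sup>2)) = (1 + m) * ellK m" using ellK_landen[OF m] by simp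
  moreover have "ellK k = (1 + l) * ellK l" unfolding k_def using l by (intro ellK_landen) auto
  ultimately show ?thesis using l
    by (simp add: period_ratio_def m1 km flip: k_def)
qed

lemma period_ratio_strict_antimono:
  assumes "0 < a" "a < b" "b < 1"
  shows "period_ratio b < period_ratio a"
proof -
  have a2: "a\<^sup>2 < b\<^sup>2" "b\<^sup>2 < 1" "0 < a\<^sup>2" using assms by (auto simp: power_strict_mono power_less_one_iff)
  have "ellK (sqrt (1 - b\<^sup>2)) < ellK (sqrt (1 - a\<^sup>2))"
    using a2 by (intro ellK_strict_mono) auto
  moreover have "ellK a < ellK b" using assms by (intro ellK_strict_mono) auto
  moreover have "0 < ellK (sqrt (1 - b\<^sup>2))" "0 < ellK a"
    using a2 assms by (auto intro!: ellK_pos)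
  ultimately show ?thesis unfolding period_ratio_def by (intro frac_less) auto
qed

text \<open>Strict monotonicity of \<open>period_ratio\<close> gives the uniqueness demanded by the
  definite description; a solution is supplied later by \<open>theta_modulus\<close>.\<close>

lemma singular_modulus_eqI:
  assumes "0 < k" "k < 1" "period_ratio k = sqrt r"
  shows "singular_modulus r = k"
  unfolding singular_modulus_def period_ratio_def[symmetric]
proof (rule the_equality)
  fix k' assume k': "0 < k' \<and> k' < 1 \<and> period_ratio k' = sqrt r"
  show "k' = k"
    using period_ratio_strict_antimono[of k k'] period_ratio_strict_antimono[of k' k] k' assms
    by (cases k k' rule: linorder_cases) auto
qed (use assms in auto)

section \<open>The complementary integral for small modulus\<close>

text \<open>Compare with the elementary integral of \<open>sin t / sqrt (1 - (1 - k\<^sup>2) sin\<^sup>2 t)\<close>.\<close>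
lemma ellK_complement_bounds:
  assumes k: "0 < k" "k < 1"
  defines "m \<equiv> sqrt (1 - k\<^sup>2)"
  shows "arsinh (m / k) / m \<le> ellK m" "ellK m \<le> arsinh (m / k) / m + pi / 2"
proof -
  have k2: "k\<^sup>2 < 1" "0 < k\<^sup>2" using k by (auto simp: power_less_one_iff)
  have m2: "m\<^sup>2 = 1 - k\<^sup>2" using k2 by (simp add: m_def)
  have m: "0 < m" "m < 1" using k2 by (auto simp: m_def)
  define w where "w t = sqrt (1 - m\<^sup>2 * (sin t)\<^sup>2)" for t
  have w: "w t > 0" for t using modulus_sin_less_1[of m t] m by (simp add: w_def)
  have w2: "(w t)\<^sup>2 = 1 - m\<^sup>2 * (sin t)\<^sup>2" for t
    using modulus_sin_less_1[of m t] m by (simp add: w_def)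
  \<comment> \<open>The antiderivative is \<open>- arsinh (m * cos t / k) / m\<close>, because
    \<open>k\<^sup>2 + m\<^sup>2 * (cos t)\<^sup>2 = (w t)\<^sup>2\<close>.\<close>
  have I: "((\<lambda>t. sin t / w t) has_integral
      (- arsinh (m * cos (pi/2) / k) / m - - arsinh (m * cos 0 / k) / m)) {0..pi/2}"
  proof (rule fundamental_theorem_of_calculus)
    fix t :: real
    have "1 + (m * cos t / k)\<^sup>2 = (k\<^sup>2 + m\<^sup>2 * (cos t)\<^sup>2) / k\<^sup>2"
      using k by (simp add: power_divide power_mult_distrib add_divide_distrib)
    also have "k\<^sup>2 + m\<^sup>2 * (cos t)\<^sup>2 = (w t)\<^sup>2" unfolding w2 m2 cos_squared_eq by algebra
    finally have e: "sqrt ((m * cos t / k)\<^sup>2 + 1) = w t / k" using k w[of t]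
      by (simp add: real_sqrt_divide add.commute)
    have "((\<lambda>t. - arsinh (m * cos t / k) / m) has_field_derivative
        - (1 / sqrt ((m * cos t / k)\<^sup>2 + 1) * (m * - sin t / k)) / m) (at t)"
      by (rule DERIV_cdivide[OF DERIV_minus[OF DERIV_chain2[OF arsinh_real_has_field_derivative]]])
         (use k in \<open>auto intro!: derivative_eq_intros\<close>)
    also have "- (1 / sqrt ((m * cos t / k)\<^sup>2 + 1) * (m * - sin t / k)) / m = sin t / w t"
      unfolding e using k m w[of t] by simp
    finally show "((\<lambda>t. - arsinh (m * cos t / k) / m) has_vector_derivative sin t / w t)
        (at t within {0..pi / 2})"
      by (simp add: has_field_derivative_at_within flip: has_real_derivative_iff_has_vector_derivative)
  qed simp
  hence I: "((\<lambda>t. sin t / w t) has_integral arsinh (m / k) / m) {0..pi/2}" by simp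
  have K: "((\<lambda>t. 1 / w t) has_integral ellK m) {0..pi/2}"
    unfolding w_def using m by (intro ellK_has_integral) auto
  show "arsinh (m / k) / m \<le> ellK m"
    by (rule has_integral_le[OF I K]) (use w in \<open>simp add: divide_right_mono less_imp_le\<close>)
  have c: "((\<lambda>t. 1 :: real) has_integral pi / 2) {0..pi/2}"
    using has_integral_const_real[of "1::real" 0 "pi/2"] by simp
  show "ellK m \<le> arsinh (m / k) / m + pi / 2"
  proof (rule has_integral_le[OF K has_integral_add[OF I c]])
    fix t :: real assume t: "t \<in> {0..pi/2}"
    have s: "0 \<le> sin t" "sin t \<le> 1" using t by (auto intro!: sin_ge_zero)
    \<comment> \<open>The goal is \<open>1 - sin t \<le> w t\<close>: the two integrands then differ
      by at most 1, which costs at most \<open>pi / 2\<close> after integration.\<close>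
    have "(1 - sin t)\<^sup>2 \<le> (1 - sin t) * (1 + sin t)"
      unfolding power2_eq_square using s by (intro mult_left_mono) auto
    also have "\<dots> = 1 - (sin t)\<^sup>2" by algebra
    also have "\<dots> \<le> (w t)\<^sup>2" unfolding w2 using m by (simp add: mult_left_le_one_le power_le_one)
    finally have "1 - sin t \<le> w t" by (rule power2_le_imp_le[OF _ less_imp_le[OF w]])
    thus "1 / w t \<le> sin t / w t + 1" using w[of t] by (simp add: field_simps)
  qed
qed

text \<open>As \<open>k\<close> tends to 0, \<open>m\<close> tends to 1 and
  \<open>arsinh (m / k)\<close> grows like \<open>ln (2 / k)\<close>, so both bounds are asymptotic
  to \<open>ln (1 / k)\<close>.\<close>

lemma ellK_complement_asymp:
  assumes k: "filterlim k (at_right 0) F"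
  shows "((\<lambda>x. ellK (sqrt (1 - (k x)\<^sup>2)) / ln (1 / k x)) \<longlongrightarrow> 1) F"
proof -
  have "((\<lambda>k. ellK (sqrt (1 - k\<^sup>2)) / ln (1 / k)) \<longlongrightarrow> 1) (at_right 0)"
  proof (rule tendsto_sandwich)
    have ev: "eventually (\<lambda>k. k \<in> {0<..<1::real}) (at_right 0)"
      by (rule eventually_at_right_real) simp
    show "eventually (\<lambda>k. arsinh (sqrt (1 - k\<^sup>2) / k) / sqrt (1 - k\<^sup>2) / ln (1 / k)
         \<le> ellK (sqrt (1 - k\<^sup>2)) / ln (1 / k)) (at_right 0)"
      using ev by eventually_elim (rule divide_right_mono, auto intro!: ellK_complement_bounds simp del: divide_divide_eq_left)
    show "eventually (\<lambda>k. ellK (sqrt (1 - k\<^sup>2)) / ln (1 / k)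
         \<le> (arsinh (sqrt (1 - k\<^sup>2) / k) / sqrt (1 - k\<^sup>2) + pi / 2) / ln (1 / k)) (at_right 0)"
      using ev by eventually_elim (rule divide_right_mono, auto intro!: ellK_complement_bounds simp del: divide_divide_eq_left)
    show "((\<lambda>k. arsinh (sqrt (1 - k\<^sup>2) / k) / sqrt (1 - k\<^sup>2) / ln (1 / k)) \<longlongrightarrow> 1) (at_right (0::real))"
      unfolding arsinh_real_def by real_asymp
    show "((\<lambda>k. (arsinh (sqrt (1 - k\<^sup>2) / k) / sqrt (1 - k\<^sup>2) + pi / 2) / ln (1 / k)) \<longlongrightarrow> 1) (at_right (0::real))"
      unfolding arsinh_real_def by real_asymp
  qed
  from filterlim_compose[OF this k] show ?thesis .
qed

section \<open>Sums of hyperbolic secants\<close>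

text \<open>The pairing of \<open>n\<close> with \<open>- 1 - n\<close> is the reflection of
  \<open>n + 1 / 2\<close> at 0, so for even functions of a half-integer the two halves
  agree.\<close>

lemma has_sum_int_split:
  fixes f :: "int \<Rightarrow> real"
  assumes "((\<lambda>n. f (int n)) has_sum a) UNIV" "((\<lambda>n. f (- 1 - int n)) has_sum b) UNIV"
  shows "(f has_sum (a + b)) UNIV"
proof -
  have "(f has_sum a) (range int)"
    using assms(1) by (subst has_sum_reindex) (auto simp: o_def)
  moreover have "(f has_sum b) (range (\<lambda>n. - 1 - int n))"
    using assms(2) by (subst has_sum_reindex) (auto simp: o_def inj_on_def)
  moreover have "range int \<inter> range (\<lambda>n. - 1 - int n) = {}" by auto
  ultimately have "(f has_sum (a + b)) (range int \<union> range (\<lambda>n. - 1 - int n))"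
    by (rule has_sum_Un_disjoint)
  also have "range int \<union> range (\<lambda>n. - 1 - int n) = UNIV"
  proof (intro equalityI subset_UNIV subsetI)
    fix n :: int
    have "n = int (nat n) \<or> n = - 1 - int (nat (- 1 - n))" by linarith
    thus "n \<in> range int \<union> range (\<lambda>n. - 1 - int n)" by blast
  qed
  finally show ?thesis .
qed

lemma has_sum_nat_Suc:
  fixes f :: "nat \<Rightarrow> real"
  assumes "((\<lambda>n. f (Suc n)) has_sum a) UNIV"
  shows "(f has_sum (f 0 + a)) UNIV"
proof -
  have "(f has_sum a) (range Suc)"
    using assms by (subst has_sum_reindex) (auto simp: o_def)
  hence "(f has_sum (f 0 + a)) (insert 0 (range Suc))"
    by (intro has_sum_insert) auto
  thus ?thesis by (simp flip: UNIV_nat_eq)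
qed

text \<open>Nonnegativity makes the iterated sum an unconditional sum over pairs, which may then be
  rearranged by index difference.\<close>

lemma has_sum_mult_nonneg:
  fixes f :: "'a \<Rightarrow> real" and g :: "'b \<Rightarrow> real"
  assumes f: "(f has_sum a) A" and g: "(g has_sum b) B"
    and "\<And>x. f x \<ge> 0" "\<And>y. g y \<ge> 0"
  shows "((\<lambda>(x, y). f x * g y) has_sum (a * b)) (A \<times> B)"
proof (rule has_sum_SigmaI)
  have 1: "((\<lambda>y. f x * g y) has_sum (f x * b)) B" for x
    by (intro has_sum_cmult_right g)
  have 2: "((\<lambda>x. f x * b) has_sum (a * b)) A"
    by (intro has_sum_cmult_left f)
  show "((\<lambda>y. case (x, y) of (x, y) \<Rightarrow> f x * g y) has_sum (f x * b)) B" for x using 1 by simp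
  show "((\<lambda>x. f x * b) has_sum (a * b)) A" by (rule 2)
  show "(\<lambda>(x, y). f x * g y) summable_on A \<times> B"
    by (rule summable_on_SigmaI[where g = "\<lambda>x. f x * b"])
       (use 1 has_sum_imp_summable[OF 2] assms in auto)
qed

text \<open>For \<open>x = 0\<close> and \<open>x = 1 / 2\<close> these are \<open>A h\<close> and
  \<open>C h\<close>, classically the squares of the theta functions theta_3 and theta_2 at nome
  \<open>exp (- h)\<close>.\<close>

definition sech_sum :: "real \<Rightarrow> real \<Rightarrow> real" where
  "sech_sum h x = (\<Sum>\<^sub>\<infinity>n::int. 1 / cosh ((of_int n + x) * h))"

text \<open>At \<open>d = 0\<close> the division by zero gives the value \<open>0\<close>, so that sums over all
  nonzero integers can be taken over all integers.\<close>
definition sinh_term :: "real \<Rightarrow> int \<Rightarrow> real" where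
  "sinh_term h d = 2 * of_int d / sinh (of_int d * h)"

lemma sinh_term_0 [simp]: "sinh_term h 0 = 0"
  by (simp add: sinh_term_def)

lemma sinh_term_minus: "sinh_term h (- d) = sinh_term h d"
  by (simp add: sinh_term_def)

text \<open>This is the addition formula for \<open>sinh\<close>. With \<open>b - a\<close> fixed
  the denominator is constant, so sums over shifts telescope.\<close>

lemma sech_mult_sech:
  fixes a b :: real
  assumes "a \<noteq> b"
  shows "1 / cosh a * (1 / cosh b) = (tanh b - tanh a) / sinh (b - a)"
proof -
  have "tanh b - tanh a = sinh (b - a) / (cosh a * cosh b)"
    by (simp add: tanh_def sinh_diff field_simps)
  thus ?thesis using assms by simp
qed

text \<open>With \<open>z = exp (- (2 * y))\<close> the square is
  \<open>4 * z / (1 + z)\<^sup>2\<close>, the differentiated geometric series at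
  \<open>- z\<close>.\<close>

lemma sech_sq_expansion:
  fixes y :: real
  assumes "y > 0"
  shows "((\<lambda>k. 4 * (- 1) ^ k * real (Suc k) * exp (- (2 * y)) ^ Suc k) has_sum (1 / cosh y * (1 / cosh y))) UNIV"
proof -
  define z where "z = exp (- (2 * y))"
  have z: "0 < z" "z < 1" using assms by (auto simp: z_def)
  have "summable (\<lambda>k. real (Suc k) * z ^ k)"
    using geometric_deriv_sums[of z] z by (auto simp: sums_iff)
  hence "summable (\<lambda>k. norm (real (Suc k) * (- z) ^ k))"
    using z by (simp add: abs_mult power_abs)
  moreover have "(\<lambda>k. real (Suc k) * (- z) ^ k) sums (1 / (1 - (- z))\<^sup>2)"
    using z by (intro geometric_deriv_sums) auto
  ultimately have "((\<lambda>k. real (Suc k) * (- z) ^ k) has_sum (1 / (1 - (- z))\<^sup>2)) UNIV"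
    by (rule norm_summable_imp_has_sum)
  hence "((\<lambda>k. (4 * z) * (real (Suc k) * (- z) ^ k)) has_sum ((4 * z) * (1 / (1 - (- z))\<^sup>2))) UNIV"
    by (rule has_sum_cmult_right)
  moreover have "(4 * z) * (real (Suc k) * (- z) ^ k) = 4 * (- 1) ^ k * real (Suc k) * z ^ Suc k" for k
    by (simp add: power_minus[of z])
  moreover have "(4 * z) * (1 / (1 - (- z))\<^sup>2) = 1 / cosh y * (1 / cosh y)"
  proof -
    define w where "w = exp (- y)"
    have w: "w > 0" "z = w\<^sup>2" by (auto simp: w_def z_def simp flip: exp_double)
    have "cosh y = (1 + z) / (2 * w)"
      unfolding cosh_def using w by (simp add: w(2) power2_eq_square field_simps) (simp add: w_def exp_minus)
    thus ?thesis using w by (simp add: power2_eq_square)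
  qed
  ultimately show ?thesis by (simp only: z_def)
qed

section \<open>Secant sums with a fixed step: telescoping and squares\<close>

context
  fixes h :: real
  assumes h: "h > 0"
begin

lemma sech_summable: "(\<lambda>n::int. 1 / cosh ((of_int n + x) * h)) summable_on UNIV"
proof (rule summable_on_comparison_test)
  define q where "q = exp (- h)"
  have q: "0 < q" "q < 1" using h by (auto simp: q_def)
  have 1: "((\<lambda>n. q ^ n) has_sum (1 / (1 - q))) UNIV"
    using q by (intro sums_nonneg_imp_has_sum geometric_sums) auto
  have e: "exp (- \<bar>of_int (int n)\<bar> * h) = q ^ n" for n
    by (simp add: q_def mult.commute flip: exp_of_nat_mult)
  have e': "exp (- \<bar>of_int (- 1 - int n)\<bar> * h) = q * q ^ n" for n
    by (simp add: q_def algebra_simps flip: exp_of_nat_mult exp_add)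
  have "((\<lambda>n::int. exp (- \<bar>of_int n\<bar> * h)) has_sum (1 / (1 - q) + q * (1 / (1 - q)))) UNIV"
    unfolding e e' by (intro has_sum_int_split; unfold e e'; intro has_sum_cmult_right 1)
  hence "(\<lambda>n::int. exp (- \<bar>of_int n\<bar> * h)) summable_on UNIV" by (rule has_sum_imp_summable)
  thus "(\<lambda>n::int. 2 * exp (\<bar>x\<bar> * h) * exp (- \<bar>of_int n\<bar> * h)) summable_on UNIV"
    by (rule summable_on_cmult_right)
  fix n :: int
  define y where "y = (of_int n + x) * h"
  have "exp \<bar>y\<bar> \<le> 2 * cosh y" by (cases "y \<ge> 0") (auto simp: cosh_def)
  hence "1 / cosh y \<le> 2 / exp \<bar>y\<bar>" by (simp add: field_simps)
  also have "2 / exp \<bar>y\<bar> = 2 * exp (- \<bar>y\<bar>)" by (simp add: exp_minus field_simps)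
  also have "\<dots> \<le> 2 * exp (\<bar>x\<bar> * h - \<bar>of_int n\<bar> * h)"
  proof -
    have "\<bar>real_of_int n\<bar> * h \<le> (\<bar>of_int n + x\<bar> + \<bar>x\<bar>) * h" using h by (intro mult_right_mono) auto
    moreover have "\<bar>y\<bar> = \<bar>of_int n + x\<bar> * h" using h by (simp add: y_def abs_mult)
    ultimately show ?thesis by (simp add: algebra_simps)
  qed
  also have "\<dots> = 2 * exp (\<bar>x\<bar> * h) * exp (- \<bar>of_int n\<bar> * h)"
    by (simp add: exp_diff exp_minus field_simps)
  finally show "1 / cosh ((of_int n + x) * h) \<le> \<dots>" by (simp add: y_def)
qed auto

lemma sech_sum_has_sum: "((\<lambda>n::int. 1 / cosh ((of_int n + x) * h)) has_sum sech_sum h x) UNIV"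
  unfolding sech_sum_def using sech_summable by (rule has_sum_infsum)

text \<open>The value 2 is the total increase of \<open>tanh\<close> from -1 to 1; monotonicity
  makes the terms nonnegative and the convergence unconditional.\<close>

lemma tanh_telescope_1:
  "((\<lambda>n::int. tanh ((of_int n + 1 + x) * h) - tanh ((of_int n + x) * h)) has_sum 2) UNIV"
proof -
  have mono: "tanh (a * h) \<le> tanh (b * h)" if "a \<le> b" for a b
    using that h by (simp add: tanh_real_le_iff)
  have lim: "filterlim (\<lambda>n. (real n + c) * h) at_top sequentially" for c
    using h by real_asymp
  have "(\<lambda>n. tanh ((real n + x) * h)) \<longlonglongrightarrow> 1"
    by (rule filterlim_compose[OF tanh_real_at_top lim])
  from telescope_sums[OF this]
  have 1: "((\<lambda>n. tanh ((of_int (int n) + 1 + x) * h) - tanh ((of_int (int n) + x) * h))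
     has_sum (1 - tanh (x * h))) UNIV"
    using mono by (intro sums_nonneg_imp_has_sum) (auto simp: add_ac)
  have "(\<lambda>n. tanh ((real n - x) * h)) \<longlonglongrightarrow> 1"
    using filterlim_compose[OF tanh_real_at_top lim[of "- x"]] by simp
  from telescope_sums[OF this]
  have "(\<lambda>n. tanh ((real (Suc n) - x) * h) - tanh ((real n - x) * h)) sums (1 + tanh (x * h))"
    by simp
  moreover have "tanh ((real (Suc n) - x) * h) = - tanh ((of_int (- 1 - int n) + x) * h)"
    "tanh ((real n - x) * h) = - tanh ((of_int (- 1 - int n) + 1 + x) * h)" for n
    by (simp_all flip: tanh_minus) (simp_all add: algebra_simps)
  ultimately have "(\<lambda>n. tanh ((of_int (- 1 - int n) + 1 + x) * h) - tanh ((of_int (- 1 - int n) + x) * h))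
     sums (1 + tanh (x * h))" by simp
  hence 2: "((\<lambda>n. tanh ((of_int (- 1 - int n) + 1 + x) * h) - tanh ((of_int (- 1 - int n) + x) * h))
     has_sum (1 + tanh (x * h))) UNIV"
    using mono by (intro sums_nonneg_imp_has_sum) auto
  from has_sum_int_split[OF 1 2] show ?thesis by simp
qed

lemma tanh_telescope:
  "((\<lambda>n::int. tanh ((of_int n + real d + x) * h) - tanh ((of_int n + x) * h)) has_sum (2 * real d)) UNIV"
proof (induction d)
  case (Suc d)
  from has_sum_add[OF tanh_telescope_1[of "real d + x"] Suc] show ?case
    by (simp add: algebra_simps)
qed simp

lemma sech_shift_has_sum_nat:
  assumes "d > 0"
  shows "((\<lambda>n::int. 1 / cosh ((of_int n + x) * h) * (1 / cosh ((of_int (n + int d) + x) * h)))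
           has_sum sinh_term h (int d)) UNIV"
proof -
  have "1 / cosh ((of_int n + x) * h) * (1 / cosh ((of_int (n + int d) + x) * h))
     = (tanh ((of_int n + real d + x) * h) - tanh ((of_int n + x) * h)) * (1 / sinh (real d * h))" for n :: int
    using assms h by (subst sech_mult_sech) (auto simp: algebra_simps diff_divide_distrib)
  moreover have "2 * real d * (1 / sinh (real d * h)) = sinh_term h (int d)"
    by (simp add: sinh_term_def)
  ultimately show ?thesis
    using has_sum_cmult_left[OF tanh_telescope[of d x], of "1 / sinh (real d * h)"] by simp
qed

lemma sech_shift_has_sum:
  assumes "d \<noteq> 0"
  shows "((\<lambda>n::int. 1 / cosh ((of_int n + x) * h) * (1 / cosh ((of_int (n + d) + x) * h)))
           has_sum sinh_term h d) UNIV"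
proof (cases "d > 0")
  case True
  thus ?thesis using sech_shift_has_sum_nat[of "nat d" x] by simp
next
  case False
  define e where "e = nat (- d)"
  have e: "d = - int e" "e > 0" using False assms by (auto simp: e_def)
  have "((\<lambda>n::int. 1 / cosh ((of_int n + x) * h) * (1 / cosh ((of_int (n + int e) + x) * h)))
           has_sum sinh_term h (int e)) UNIV"
    using e by (intro sech_shift_has_sum_nat)
  also have "?this \<longleftrightarrow> ?thesis"
    by (rule has_sum_reindex_bij_witness[of _ "\<lambda>n. n + d" "\<lambda>n. n - d"])
       (auto simp: e sinh_term_minus)
  finally show ?thesis .
qed

lemma sech_sq_summable: "(\<lambda>n::int. 1 / cosh ((of_int n + x) * h) * (1 / cosh ((of_int n + x) * h))) summable_on UNIV"
proof (rule summable_on_comparison_test[OF sech_summable[of x]])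
  fix n :: int
  show "1 / cosh ((of_int n + x) * h) * (1 / cosh ((of_int n + x) * h)) \<le> 1 / cosh ((of_int n + x) * h)"
    using cosh_real_ge_1[of "(of_int n + x) * h"] by (intro mult_left_le) auto
qed auto

text \<open>The pairs in the product are sorted by their difference \<open>d\<close>. Each
  \<open>d\<close> other than 0 contributes \<open>sinh_term h d\<close> independently of
  \<open>x\<close>; the diagonal is the subtracted sum of squares.\<close>

lemma sech_sum_square:
  "(sinh_term h has_sum
     ((sech_sum h x)\<^sup>2 - (\<Sum>\<^sub>\<infinity>n::int. 1 / cosh ((of_int n + x) * h) * (1 / cosh ((of_int n + x) * h))))) UNIV"
proof -
  define c where "c n = 1 / cosh ((of_int n + x) * h)" for n :: int
  define s where "s = (\<Sum>\<^sub>\<infinity>n::int. c n * c n)"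
  have "((\<lambda>(n, m). c n * c m) has_sum (sech_sum h x * sech_sum h x)) (UNIV \<times> UNIV)"
    unfolding c_def by (intro has_sum_mult_nonneg sech_sum_has_sum) auto
  also have "?this \<longleftrightarrow> ((\<lambda>(d, n). c n * c (n + d)) has_sum (sech_sum h x * sech_sum h x)) (UNIV \<times> UNIV)"
    by (rule has_sum_reindex_bij_witness[of _ "\<lambda>(d, n). (n, n + d)" "\<lambda>(n, m). (m - n, n)"]) auto
  finally have "((\<lambda>d. if d = 0 then s else sinh_term h d) has_sum (sech_sum h x * sech_sum h x)) UNIV"
  proof (rule has_sum_SigmaD)
    fix d :: int
    show "((\<lambda>n. case (d, n) of (d, n) \<Rightarrow> c n * c (n + d)) has_sum (if d = 0 then s else sinh_term h d)) UNIV"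
      using sech_shift_has_sum[of d x] has_sum_infsum[OF sech_sq_summable[of x]]
      by (auto simp: c_def s_def)
  qed
  \<comment> \<open>Removing the diagonal leaves 0 at \<open>d = 0\<close>, which is the default
    value \<open>sinh_term h 0\<close>.\<close>
  moreover have "((\<lambda>d::int. if d = 0 then - s else 0) has_sum (- s)) UNIV"
    by (rule has_sum_finite_neutralI[of "{0}"]) auto
  ultimately have "((\<lambda>d. (if d = 0 then s else sinh_term h d) + (if d = 0 then - s else 0)) has_sum
     (sech_sum h x * sech_sum h x + (- s))) UNIV"
    by (rule has_sum_add)
  moreover have "(if d = 0 then s else sinh_term h d) + (if d = 0 then - s else 0) = sinh_term h d" for d
    by auto
  ultimately show ?thesis by (simp add: s_def c_def power2_eq_square)
qed

lemma sinh_term_summable: "sinh_term h summable_on UNIV"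
  using sech_sum_square[of 0] by (rule has_sum_imp_summable)

text \<open>Each squared secant is expanded in exponentials and the summations are interchanged. At
  half-integers the inner geometric series is exactly \<open>1 / (2 * sinh ((k + 1) * h))\<close>.
  The signs are chosen by the expansion so that adding \<open>sech_sum_square\<close> cancels all
  even \<open>d\<close>.\<close>

lemma sech_sq_half_has_sum:
  "((\<lambda>d. if even d then - sinh_term h d else sinh_term h d) has_sum
      (\<Sum>\<^sub>\<infinity>n::int. 1 / cosh ((of_int n + 1 / 2) * h) * (1 / cosh ((of_int n + 1 / 2) * h)))) UNIV"
proof -
  define F where "F n = 1 / cosh ((of_int n + 1 / 2) * h) * (1 / cosh ((of_int n + 1 / 2) * h))" for n :: int
  define t where "t = (\<lambda>(k, n). 4 * (- 1) ^ k * real (Suc k) * exp (- (2 * ((real n + 1 / 2) * h))) ^ Suc k)"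
  have inner: "((\<lambda>n. exp (- (2 * ((real n + 1 / 2) * h))) ^ Suc k) has_sum (1 / (2 * sinh (real (Suc k) * h)))) UNIV" for k
  proof -
    define p where "p = exp (- (real (Suc k) * h))"
    have "real (Suc k) * h > 0" using h by (intro mult_pos_pos) auto
    hence p: "0 < p" "p < 1" "p\<^sup>2 < 1" by (auto simp: p_def power_less_one_iff)
    have "((\<lambda>n. (p\<^sup>2) ^ n) has_sum (1 / (1 - p\<^sup>2))) UNIV"
      using p by (intro sums_nonneg_imp_has_sum geometric_sums) auto
    hence "((\<lambda>n. p * (p\<^sup>2) ^ n) has_sum (p * (1 / (1 - p\<^sup>2)))) UNIV" by (rule has_sum_cmult_right)
    moreover have "p * (p\<^sup>2) ^ n = exp (- (2 * ((real n + 1 / 2) * h))) ^ Suc k" for n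
      unfolding p_def by (simp add: algebra_simps flip: exp_of_nat_mult exp_add exp_double del: of_nat_Suc)
         (simp add: algebra_simps)
    moreover have "p * (1 / (1 - p\<^sup>2)) = 1 / (2 * sinh (real (Suc k) * h))"
    proof -
      have "2 * sinh (real (Suc k) * h) = 1 / p - p"
        by (simp add: sinh_def p_def exp_minus inverse_eq_divide del: of_nat_Suc)
      also have "\<dots> = (1 - p\<^sup>2) / p" using p by (simp add: power2_eq_square diff_divide_distrib)
      finally have S: "2 * sinh (real (Suc k) * h) = (1 - p\<^sup>2) / p" .
      show ?thesis unfolding S by simp
    qed
    ultimately show ?thesis by simp
  qed
  have S: "sinh_term h (int (Suc k)) = 4 * real (Suc k) * (1 / (2 * sinh (real (Suc k) * h)))" for k
    by (simp add: sinh_term_def del: of_nat_Suc)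
  \<comment> \<open>The interchange needs absolute summability. The inner sums of absolute values
    are \<open>sinh_term h (k + 1)\<close>, summable as a by-product of
    \<open>sech_sum_square\<close>.\<close>
  have "(\<lambda>x. norm (t x)) summable_on (UNIV \<times> UNIV)"
  proof (rule summable_on_SigmaI)
    fix k :: nat
    have "((\<lambda>n. 4 * real (Suc k) * exp (- (2 * ((real n + 1 / 2) * h))) ^ Suc k) has_sum sinh_term h (int (Suc k))) UNIV"
      unfolding S by (intro has_sum_cmult_right inner)
    thus "((\<lambda>n. norm (t (k, n))) has_sum sinh_term h (int (Suc k))) UNIV"
      by (simp add: t_def abs_mult)
  next
    have "sinh_term h summable_on ((\<lambda>k. int (Suc k)) ` UNIV)"
      using sinh_term_summable by (rule summable_on_subset) auto
    thus "(\<lambda>k. sinh_term h (int (Suc k))) summable_on UNIV"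
      by (subst (asm) summable_on_reindex) (auto simp: o_def inj_on_def)
  qed auto
  hence "t summable_on (UNIV \<times> UNIV)" by (rule abs_summable_summable)
  then obtain a where a: "(t has_sum a) (UNIV \<times> UNIV)" by (auto simp: summable_on_def)
  have 1: "((\<lambda>k. (- 1) ^ k * sinh_term h (int (Suc k))) has_sum a) UNIV"
  proof (rule has_sum_SigmaD[OF a])
    fix k
    have "((\<lambda>n. 4 * (- 1) ^ k * real (Suc k) * exp (- (2 * ((real n + 1 / 2) * h))) ^ Suc k)
        has_sum (4 * (- 1) ^ k * real (Suc k) * (1 / (2 * sinh (real (Suc k) * h))))) UNIV"
      by (intro has_sum_cmult_right inner)
    moreover have "4 * (- 1) ^ k * real (Suc k) * (1 / (2 * sinh (real (Suc k) * h)))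
        = (- 1) ^ k * sinh_term h (int (Suc k))"
      unfolding S by (simp only: mult_ac)
    ultimately show "((\<lambda>n. t (k, n)) has_sum ((- 1) ^ k * sinh_term h (int (Suc k)))) UNIV"
      by (simp only: t_def prod.case)
  qed
  have "((\<lambda>(n, k). t (k, n)) has_sum a) (UNIV \<times> UNIV)" using a by (subst (asm) has_sum_swap)
  hence 2: "((\<lambda>n. F (int n)) has_sum a) UNIV"
  proof (rule has_sum_SigmaD)
    fix n
    show "((\<lambda>k. case (n, k) of (n, k) \<Rightarrow> t (k, n)) has_sum F (int n)) UNIV"
      using sech_sq_expansion[of "(real n + 1 / 2) * h"] h by (simp add: t_def F_def)
  qed
  have "F (- 1 - int n) = F (int n)" for n
  proof -
    have "(of_int (- 1 - int n) + 1 / 2) * h = - ((of_int (int n) + 1 / 2) * h)" by (simp add: algebra_simps)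
    thus ?thesis unfolding F_def by (simp only: cosh_minus)
  qed
  hence "(F has_sum (a + a)) UNIV" using 2 by (intro has_sum_int_split) auto
  hence F: "(\<Sum>\<^sub>\<infinity>n. F n) = a + a" by (rule infsumI)
  \<comment> \<open>With \<open>d = k + 1\<close>, odd \<open>d\<close> means even \<open>k\<close>,
    so the sign is \<open>(- 1) ^ k\<close>. The value at \<open>d = 0\<close> is 0, and negative
    \<open>d\<close> repeat the positive ones.\<close>
  define w where "w d = (if even d then - sinh_term h d else sinh_term h d)" for d
  have w: "w (int (Suc k)) = (- 1) ^ k * sinh_term h (int (Suc k))" for k
    by (simp add: w_def)
  have w': "w (- 1 - int k) = (- 1) ^ k * sinh_term h (int (Suc k))" for k
    using sinh_term_minus[of h "1 + int k"] by (simp add: w_def)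
  have "((\<lambda>n. w (int n)) has_sum (w (int 0) + a)) UNIV"
    by (rule has_sum_nat_Suc) (use 1 in \<open>simp only: w\<close>)
  moreover have "w (int 0) = 0" by (simp add: w_def)
  ultimately have "((\<lambda>n. w (int n)) has_sum a) UNIV" by simp
  hence "(w has_sum (a + a)) UNIV" by (rule has_sum_int_split) (use 1 in \<open>simp only: w'\<close>)
  thus ?thesis unfolding F[symmetric] unfolding w_def[abs_def] F_def .
qed

end

section \<open>Splitting by parity and doubling the step\<close>

context
  fixes h :: real
  assumes h: "h > 0"
begin

text \<open>Writing \<open>n = 2 * m\<close>, or \<open>n = 2 * (m + 1 / 2)\<close> in the odd case,
  doubles the step. The context is reopened because earlier facts are now taken at
  \<open>2 * h\<close>.\<close>

lemma sech_even_has_sum: "((\<lambda>n::int. 1 / cosh (of_int n * h)) has_sum sech_sum (2 * h) 0) {n. even n}"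
proof -
  have "((\<lambda>n::int. 1 / cosh ((of_int n + 0) * (2 * h))) has_sum sech_sum (2 * h) 0) UNIV"
    by (rule sech_sum_has_sum) (use h in simp)
  also have "?this \<longleftrightarrow> ?thesis"
    by (rule has_sum_reindex_bij_witness[of _ "\<lambda>n. n div 2" "\<lambda>n. 2 * n"]) (auto simp: algebra_simps)
  finally show ?thesis .
qed

lemma sech_odd_has_sum: "((\<lambda>n::int. 1 / cosh (of_int n * h)) has_sum sech_sum (2 * h) (1 / 2)) {n. odd n}"
proof -
  have "((\<lambda>n::int. 1 / cosh ((of_int n + 1 / 2) * (2 * h))) has_sum sech_sum (2 * h) (1 / 2)) UNIV"
    by (rule sech_sum_has_sum) (use h in simp)
  also have "?this \<longleftrightarrow> ?thesis"
    by (rule has_sum_reindex_bij_witness[of _ "\<lambda>n. n div 2" "\<lambda>n. 2 * n + 1"])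
       (auto simp: algebra_simps, presburger)
  finally show ?thesis .
qed

lemma sech_sum_0_double: "sech_sum h 0 = sech_sum (2 * h) 0 + sech_sum (2 * h) (1 / 2)"
proof -
  have "((\<lambda>n::int. 1 / cosh (of_int n * h)) has_sum (sech_sum (2 * h) 0 + sech_sum (2 * h) (1 / 2)))
      ({n. even n} \<union> {n. odd n})"
    by (intro has_sum_Un_disjoint sech_even_has_sum sech_odd_has_sum) auto
  also have "{n::int. even n} \<union> {n. odd n} = UNIV" by auto
  finally show ?thesis using sech_sum_has_sum[OF h, of 0] by (simp add: has_sum_unique)
qed

text \<open>Both sides equal twice the sum of \<open>sinh_term h d\<close> over odd \<open>d\<close>.\<close>
lemma sech_sum_half_double: "(sech_sum h (1 / 2))\<^sup>2 = 4 * sech_sum (2 * h) 0 * sech_sum (2 * h) (1 / 2)"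
proof -
  define g where "g n = 1 / cosh (of_int n * h)" for n :: int
  define a c where "a = sech_sum (2 * h) 0" and "c = sech_sum (2 * h) (1 / 2)"
  have ev: "(g has_sum a) {n. even n}" and od: "(g has_sum c) {n. odd n}"
    using sech_even_has_sum sech_odd_has_sum by (auto simp: g_def[abs_def] a_def c_def)
  have g0: "g n \<ge> 0" for n by (simp add: g_def)
  \<comment> \<open>Pairs of opposite parity are exactly the pairs with odd difference; the two
    orders give the factor 2.\<close>
  have "((\<lambda>(n, m). g n * g m) has_sum (a * c + c * a)) ({n. even n} \<times> {n. odd n} \<union> {n. odd n} \<times> {n. even n})"
    by (intro has_sum_Un_disjoint has_sum_mult_nonneg ev od g0) auto
  also have "?this \<longleftrightarrow> ((\<lambda>(d, n). g n * g (n + d)) has_sum (a * c + c * a)) ({d. odd d} \<times> UNIV)"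
    by (rule has_sum_reindex_bij_witness[of _ "\<lambda>(d, n). (n, n + d)" "\<lambda>(n, m). (m - n, n)"]) auto
  finally have "(sinh_term h has_sum (a * c + c * a)) {d. odd d}"
  proof (rule has_sum_SigmaD)
    fix d :: int assume "d \<in> {d. odd d}"
    hence "d \<noteq> 0" by auto
    from sech_shift_has_sum[OF h this, of 0]
    show "((\<lambda>n. case (d, n) of (d, n) \<Rightarrow> g n * g (n + d)) has_sum sinh_term h d) UNIV"
      by (simp add: g_def)
  qed
  from has_sum_cmult_right[OF this, of 2]
  have 1: "((\<lambda>d. 2 * sinh_term h d) has_sum (4 * a * c)) {d. odd d}"
    by (simp add: algebra_simps)
  \<comment> \<open>The sums of squares cancel in this addition; the terms vanish for even
    \<open>d\<close> and double for odd \<open>d\<close>.\<close>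
  have "((\<lambda>d. sinh_term h d + (if even d then - sinh_term h d else sinh_term h d)) has_sum
      (sech_sum h (1 / 2))\<^sup>2) UNIV"
    using has_sum_add[OF sech_sum_square[OF h, of "1 / 2"] sech_sq_half_has_sum[OF h]] by simp
  also have "?this \<longleftrightarrow> ((\<lambda>d. 2 * sinh_term h d) has_sum (sech_sum h (1 / 2))\<^sup>2) {d. odd d}"
    by (rule has_sum_cong_neutral) auto
  finally show ?thesis using 1 unfolding a_def c_def by (rule has_sum_unique)
qed

text \<open>This links the continued fraction to the secant sums. With
  \<open>w = sqrt q * q ^ k\<close> the secant is \<open>2 * w / (1 + w\<^sup>2)\<close>, and the
  reflection doubles the sum, whence the factor 4.\<close>

lemma sech_sum_half_lamb: "sech_sum h (1 / 2) = 4 * (sqrt (exp (- h)) * lamb (exp (- h)) 0)"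
proof -
  define q where "q = exp (- h)"
  have q: "0 < q" "q < 1" using h by (auto simp: q_def)
  have sq: "sqrt q = exp (- h / 2)"
    unfolding q_def by (rule real_sqrt_unique) (auto simp flip: exp_double)
  define F where "F n = 1 / cosh ((of_int n + 1 / 2) * h)" for n :: int
  have "((\<lambda>k. 2 * sqrt q * (q ^ ((2 * 0 + 1) * k) / (1 + q ^ (2 * k + 1)))) has_sum
       (2 * sqrt q * lamb q 0)) UNIV"
    using q by (intro has_sum_cmult_right sums_nonneg_imp_has_sum lamb_sums) auto
  moreover have "2 * sqrt q * (q ^ ((2 * 0 + 1) * k) / (1 + q ^ (2 * k + 1))) = F (int k)" for k
  proof -
    define w where "w = sqrt q * q ^ k"
    have w0: "w > 0" using q by (simp add: w_def)
    have w2: "q ^ (2 * k + 1) = w\<^sup>2"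
      using q by (simp add: w_def power_mult_distrib power_even_eq)
    have w: "w = exp (- ((real k + 1 / 2) * h))"
      unfolding w_def sq unfolding q_def by (simp add: algebra_simps flip: exp_of_nat_mult exp_add)
    have "cosh ((real k + 1 / 2) * h) = (1 / w + w) / 2"
      unfolding w by (simp add: cosh_def exp_minus inverse_eq_divide)
    also have "\<dots> = (1 + w\<^sup>2) / (2 * w)"
      using w0 by (simp add: power2_eq_square add_divide_distrib)
    finally have "F (int k) = 2 * w / (1 + w\<^sup>2)" by (simp add: F_def)
    thus ?thesis unfolding w2 by (simp add: w_def)
  qed
  ultimately have 1: "((\<lambda>n. F (int n)) has_sum (2 * sqrt q * lamb q 0)) UNIV" by simp
  have "F (- 1 - int n) = F (int n)" for n
  proof -
    have "(of_int (- 1 - int n) + 1 / 2) * h = - ((of_int (int n) + 1 / 2) * h)" by (simp add: algebra_simps)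
    thus ?thesis unfolding F_def by (simp only: cosh_minus)
  qed
  hence "(F has_sum (2 * sqrt q * lamb q 0 + 2 * sqrt q * lamb q 0)) UNIV"
    using 1 by (intro has_sum_int_split) auto
  thus ?thesis using sech_sum_has_sum[OF h, of "1 / 2"]
    unfolding F_def[abs_def] q_def by (auto dest: has_sum_unique)
qed

lemma sech_sum_half_pos: "sech_sum h (1 / 2) > 0"
  unfolding sech_sum_half_lamb using h by (auto intro!: mult_pos_pos lamb_pos)

text \<open>The central term is 1, and on either side the secants are dominated by
  \<open>2 * q ^ n\<close> with \<open>q = exp (- h)\<close>.\<close>

lemma sech_sum_0_bounds:
  "1 \<le> sech_sum h 0" "sech_sum h 0 \<le> 1 + 4 * exp (- h) / (1 - exp (- h))"
proof -
  define q where "q = exp (- h)"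
  have q: "0 < q" "q < 1" using h by (auto simp: q_def)
  define F where "F n = 1 / cosh (of_int n * h)" for n :: int
  have "(\<lambda>n. F (int (Suc n))) summable_on UNIV"
  proof -
    have "F summable_on ((\<lambda>k. int (Suc k)) ` UNIV)"
      using sech_summable[OF h, of 0] unfolding F_def[abs_def] by (auto intro: summable_on_subset)
    thus ?thesis by (subst (asm) summable_on_reindex) (auto simp: o_def inj_on_def)
  qed
  then obtain s where s: "((\<lambda>n. F (int (Suc n))) has_sum s) UNIV" by (auto simp: summable_on_def)
  have s0: "s \<ge> 0" using s by (rule has_sum_nonneg) (simp add: F_def)
  have "((\<lambda>n. q ^ n) has_sum (1 / (1 - q))) UNIV"
    using q by (intro sums_nonneg_imp_has_sum geometric_sums) auto
  hence g: "((\<lambda>n. 2 * q * q ^ n) has_sum (2 * q * (1 / (1 - q)))) UNIV" by (rule has_sum_cmult_right)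
  have s1: "s \<le> 2 * q * (1 / (1 - q))"
  proof (rule has_sum_mono[OF s g])
    fix n :: nat
    define p where "p = q ^ Suc n"
    have p: "p > 0" "p = exp (- (real (Suc n) * h))"
      using q by (auto simp: p_def q_def exp_of_nat_mult[symmetric] simp del: power_Suc of_nat_Suc)
    have "cosh (real (Suc n) * h) = (1 / p + p) / 2"
      unfolding p by (simp add: cosh_def exp_minus inverse_eq_divide del: of_nat_Suc)
    moreover have "(1 / p + p) / 2 \<ge> 1 / (2 * p)" using p(1) by (simp add: field_simps)
    ultimately have "1 / cosh (real (Suc n) * h) \<le> 1 / (1 / (2 * p))"
      using p(1) by (intro divide_left_mono) auto
    thus "F (int (Suc n)) \<le> 2 * q * q ^ n" by (simp add: F_def p_def)
  qed
  have "((\<lambda>n. F (int n)) has_sum (F (int 0) + s)) UNIV" by (rule has_sum_nat_Suc[OF s])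
  moreover have "F (- 1 - int n) = F (int (Suc n))" for n
  proof -
    have "of_int (- 1 - int n) * h = - (of_int (int (Suc n)) * h)" by (simp add: algebra_simps)
    thus ?thesis unfolding F_def by (simp only: cosh_minus)
  qed
  ultimately have "(F has_sum (F (int 0) + s + s)) UNIV" using s by (intro has_sum_int_split) auto
  hence "sech_sum h 0 = 1 + 2 * s" using sech_sum_has_sum[OF h, of 0]
    unfolding F_def[abs_def] by (auto dest: has_sum_unique)
  thus "1 \<le> sech_sum h 0" "sech_sum h 0 \<le> 1 + 4 * exp (- h) / (1 - exp (- h))"
    using s0 s1 by (auto simp: q_def)
qed

end

section \<open>The modulus as a function of the nome\<close>

text \<open>In \<open>lamb_0_1\<close>, the summand with \<open>lamb q 1\<close> is dropped for the
  upper bound; for the lower one \<open>lamb q 1\<close> is replaced by the larger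
  \<open>lamb q 0\<close>.\<close>

lemma lamb_0_bounds:
  assumes "0 < q" "q < 1"
  shows "1 / (1 + q) \<le> lamb q 0" "lamb q 0 \<le> 1 / (1 - q)"
proof -
  have "(1 - q) * lamb q 0 \<le> 1"
    using lamb_0_1[OF assms] lamb_pos[OF assms, of 1] assms
    by (simp add: distrib_left) (smt (verit) mult_nonneg_nonneg)
  thus "lamb q 0 \<le> 1 / (1 - q)" using assms by (simp add: field_simps)
  have "(1 - q) * (lamb q 0 + q * lamb q 1) \<le> (1 - q) * (lamb q 0 + q * lamb q 0)"
    using lamb_Suc_le[OF assms, of 0] assms by (intro mult_left_mono add_left_mono) auto
  hence "1 \<le> (1 - q) * (1 + q) * lamb q 0" unfolding lamb_0_1[OF assms] by (simp add: algebra_simps)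
  also have "\<dots> \<le> (1 * (1 + q)) * lamb q 0"
    using assms lamb_pos[OF assms, of 0] by (intro mult_right_mono) auto
  finally show "1 / (1 + q) \<le> lamb q 0" using assms by (simp add: field_simps)
qed

text \<open>This is \<open>k h\<close>, classically the modulus theta_2^2 / theta_3^2 with nome
  \<open>exp (- h)\<close>.\<close>

definition theta_modulus :: "real \<Rightarrow> real" where
  "theta_modulus h = sech_sum h (1 / 2) / sech_sum h 0"

lemma tendsto_sech_sum_0: "((\<lambda>h. sech_sum h 0) \<longlongrightarrow> 1) at_top"
proof (rule tendsto_sandwich[OF _ _ tendsto_const])
  show "((\<lambda>h::real. 1 + 4 * exp (- h) / (1 - exp (- h))) \<longlongrightarrow> 1) at_top" by real_asymp
qed (auto intro!: eventually_mono[OF eventually_gt_at_top[of "0::real"]] sech_sum_0_bounds)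

lemma tendsto_lamb_0: "((\<lambda>h. lamb (exp (- h)) 0) \<longlongrightarrow> 1) at_top"
proof (rule tendsto_sandwich)
  show "((\<lambda>h::real. 1 / (1 + exp (- h))) \<longlongrightarrow> 1) at_top" by real_asymp
  show "((\<lambda>h::real. 1 / (1 - exp (- h))) \<longlongrightarrow> 1) at_top" by real_asymp
qed (auto intro!: eventually_mono[OF eventually_gt_at_top[of "0::real"]] lamb_0_bounds)

text \<open>The modulus behaves like \<open>4 * exp (- h / 2)\<close>, which determines the growth
  of \<open>ln (1 / theta_modulus h)\<close>.\<close>

lemma tendsto_theta_modulus_scaled: "((\<lambda>h. theta_modulus h * exp (h / 2)) \<longlongrightarrow> 4) at_top"
proof -
  have "((\<lambda>h. 4 * lamb (exp (- h)) 0 / sech_sum h 0) \<longlongrightarrow> 4 * 1 / 1) at_top"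
    by (intro tendsto_intros tendsto_lamb_0 tendsto_sech_sum_0) auto
  moreover have "eventually (\<lambda>h. 4 * lamb (exp (- h)) 0 / sech_sum h 0 = theta_modulus h * exp (h / 2)) at_top"
    using eventually_gt_at_top[of 0]
  proof eventually_elim
    case (elim h)
    have "sqrt (exp (- h)) = exp (- h / 2)"
      by (rule real_sqrt_unique) (auto simp flip: exp_double)
    hence "sqrt (exp (- h)) * exp (h / 2) = 1" by (simp flip: exp_add)
    thus ?case using elim by (simp add: theta_modulus_def sech_sum_half_lamb)
  qed
  ultimately show ?thesis by (simp add: Lim_transform_eventually)
qed

lemma theta_modulus_pos: "h > 0 \<Longrightarrow> theta_modulus h > 0"
  unfolding theta_modulus_def
  using sech_sum_half_pos[of h] sech_sum_0_bounds(1)[of h] by (intro divide_pos_pos) auto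

lemma filterlim_theta_modulus: "filterlim theta_modulus (at_right 0) at_top"
proof -
  have "((\<lambda>h. theta_modulus h * exp (h / 2) * exp (- h / 2)) \<longlongrightarrow> 4 * 0) at_top"
    by (intro tendsto_mult tendsto_theta_modulus_scaled) real_asymp
  moreover have "theta_modulus h * exp (h / 2) * exp (- h / 2) = theta_modulus h" for h
    by (simp add: mult.assoc flip: exp_add)
  ultimately have "(theta_modulus \<longlongrightarrow> 0) at_top" by (simp only: mult_zero_right)
  moreover have "eventually (\<lambda>h. theta_modulus h \<in> {0<..}) at_top"
    using eventually_gt_at_top[of 0] by eventually_elim (simp add: theta_modulus_pos)
  ultimately show ?thesis by (simp add: filterlim_at eventually_mono)
qed

section \<open>The Landen step from \<open>2 * h\<close> to \<open>h\<close> and its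
  invariants\<close>

lemma sech_sum_0_pos: "h > 0 \<Longrightarrow> sech_sum h 0 > 0"
  using sech_sum_0_bounds(1)[of h] by simp

text \<open>Divided by \<open>sech_sum (2 * h) 0\<close>, the doubling formulas give
  \<open>1 + l\<close> for the integer sum and \<open>4 * l\<close> for the square of the
  half-integer sum; positivity selects the root.\<close>

lemma theta_modulus_landen:
  assumes "h > 0"
  defines "l \<equiv> theta_modulus (2 * h)"
  shows "theta_modulus h = 2 * sqrt l / (1 + l)" "sech_sum h 0 = (1 + l) * sech_sum (2 * h) 0"
    "sech_sum h (1 / 2) = 2 * sqrt l * sech_sum (2 * h) 0"
proof -
  define a c where "a = sech_sum (2 * h) 0" and "c = sech_sum (2 * h) (1 / 2)"
  have a: "a > 0" using assms sech_sum_0_pos[of "2 * h"] by (simp add: a_def)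
  have c: "c > 0" using assms sech_sum_half_pos[of "2 * h"] by (simp add: c_def)
  have l: "l = c / a" by (simp add: l_def theta_modulus_def a_def c_def)
  show A: "sech_sum h 0 = (1 + l) * sech_sum (2 * h) 0"
    using sech_sum_0_double[OF assms(1)] a by (simp add: l flip: a_def c_def) (simp add: field_simps)
  show C: "sech_sum h (1 / 2) = 2 * sqrt l * sech_sum (2 * h) 0"
  proof (rule power2_eq_imp_eq)
    show "(sech_sum h (1 / 2))\<^sup>2 = (2 * sqrt l * sech_sum (2 * h) 0)\<^sup>2"
      using sech_sum_half_double[OF assms(1)] a c
      by (simp add: power_mult_distrib l flip: a_def c_def) (simp add: power2_eq_square)
  qed (use a c l sech_sum_half_pos[OF assms(1)] in \<open>auto simp flip: a_def\<close>)
  show "theta_modulus h = 2 * sqrt l / (1 + l)"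
    unfolding theta_modulus_def A C using a by (simp flip: a_def)
qed

lemma doubling_invariant_eq_limit:
  fixes F :: "real \<Rightarrow> real"
  assumes inv: "\<And>h. h > 0 \<Longrightarrow> F (2 * h) = F h" and lim: "(F \<longlongrightarrow> L) at_top" and h: "h > 0"
  shows "F h = L"
proof -
  have "filterlim (\<lambda>n::nat. 2 ^ n * h) at_top sequentially" using h by real_asymp
  hence "(\<lambda>n. F (2 ^ n * h)) \<longlonglongrightarrow> L" by (rule filterlim_compose[OF lim])
  moreover have "F (2 ^ n * h) = F h" for n
    by (induction n) (use inv[of "2 ^ _ * h"] h in \<open>auto simp: mult.assoc\<close>)
  ultimately show ?thesis by (simp add: LIMSEQ_const_iff)
qed

text \<open>Since \<open>2 * sqrt l < 1 + l\<close> for \<open>l < 1\<close>, the bound passes from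
  \<open>2 * h\<close> to \<open>h\<close>. It holds at \<open>2 ^ n * h\<close> for large
  \<open>n\<close> and descends from there.\<close>

lemma theta_modulus_less_1:
  assumes "h > 0"
  shows "theta_modulus h < 1"
proof -
  have step: "theta_modulus x < 1" if "x > 0" "theta_modulus (2 * x) < 1" for x
  proof -
    define l where "l = theta_modulus (2 * x)"
    have l: "0 < l" "l < 1" using that by (auto simp: l_def theta_modulus_pos)
    have "(1 - sqrt l)\<^sup>2 > 0" using l by simp
    hence "2 * sqrt l < 1 + l" using l by (simp add: power2_diff)
    thus ?thesis using l unfolding theta_modulus_landen(1)[OF that(1)] by (simp flip: l_def)
  qed
  have red: "theta_modulus x < 1" if "x > 0" "theta_modulus (2 ^ n * x) < 1" for n x
    using that
  proof (induction n arbitrary: x)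
    case (Suc n)
    have "theta_modulus (2 * x) < 1"
      by (rule Suc.IH) (use Suc.prems in \<open>simp_all add: mult_ac\<close>)
    thus ?case using Suc.prems(1) by (rule step[rotated])
  qed simp
  have "filterlim (\<lambda>n::nat. 2 ^ n * h) at_top sequentially" using assms by real_asymp
  moreover have "(theta_modulus \<longlongrightarrow> 0) at_top"
    using filterlim_theta_modulus by (auto simp: filterlim_at)
  ultimately have "(\<lambda>n. theta_modulus (2 ^ n * h)) \<longlonglongrightarrow> 0" by (rule filterlim_compose[rotated])
  hence "eventually (\<lambda>n. theta_modulus (2 ^ n * h) < 1) sequentially"
    by (rule order_tendstoD) simp
  then obtain n where "theta_modulus (2 ^ n * h) < 1" by (auto simp: eventually_sequentially)
  thus ?thesis by (rule red[OF assms])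
qed

text \<open>Passing from \<open>2 * h\<close> to \<open>h\<close> multiplies both
  \<open>ellK\<close> and \<open>sech_sum\<close> by the same \<open>1 + l\<close>; at infinity the
  quotient is \<open>ellK 0 / 1\<close>.\<close>

lemma ellK_theta_modulus:
  assumes "h > 0"
  shows "ellK (theta_modulus h) = pi / 2 * sech_sum h 0"
proof -
  have "ellK (theta_modulus h) / sech_sum h 0 = pi / 2"
  proof (rule doubling_invariant_eq_limit[OF _ _ assms])
    fix h :: real assume h: "h > 0"
    have "ellK (theta_modulus h) = (1 + theta_modulus (2 * h)) * ellK (theta_modulus (2 * h))"
      unfolding theta_modulus_landen(1)[OF h] using h theta_modulus_pos[of "2 * h"] theta_modulus_less_1[of "2 * h"]
      by (intro ellK_landen) auto
    thus "ellK (theta_modulus (2 * h)) / sech_sum (2 * h) 0 = ellK (theta_modulus h) / sech_sum h 0"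
      unfolding theta_modulus_landen(2)[OF h] using h theta_modulus_pos[of "2 * h"] by simp
  next
    have "(theta_modulus \<longlongrightarrow> 0) at_top"
      using filterlim_theta_modulus by (auto simp: filterlim_at)
    hence "((\<lambda>h. ellK (theta_modulus h)) \<longlongrightarrow> pi / 2) at_top"
      by (intro tendsto_ellK_0)
         (auto intro!: eventually_mono[OF eventually_gt_at_top[of "0::real"]]
           simp: theta_modulus_less_1 theta_modulus_pos less_imp_le)
    hence "((\<lambda>h. ellK (theta_modulus h) / sech_sum h 0) \<longlongrightarrow> pi / 2 / 1) at_top"
      by (intro tendsto_divide tendsto_sech_sum_0) auto
    thus "((\<lambda>h. ellK (theta_modulus h) / sech_sum h 0) \<longlongrightarrow> pi / 2) at_top" by simp
  qed
  thus ?thesis using sech_sum_0_pos[OF assms] by (simp add: field_simps)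
qed

lemma period_ratio_theta_modulus:
  assumes "h > 0"
  shows "period_ratio (theta_modulus h) = h / pi"
proof -
  have "period_ratio (theta_modulus h) / h = 1 / pi"
  proof (rule doubling_invariant_eq_limit[OF _ _ assms])
    fix h :: real assume h: "h > 0"
    have "period_ratio (theta_modulus (2 * h)) = 2 * period_ratio (theta_modulus h)"
      unfolding theta_modulus_landen(1)[OF h] using h
      by (intro period_ratio_landen theta_modulus_pos theta_modulus_less_1) auto
    thus "period_ratio (theta_modulus (2 * h)) / (2 * h) = period_ratio (theta_modulus h) / h" by simp
  next
    define k where "k = theta_modulus"
    have 1: "((\<lambda>h. ellK (sqrt (1 - (k h)\<^sup>2)) / ln (1 / k h)) \<longlongrightarrow> 1) at_top"
      unfolding k_def by (rule ellK_complement_asymp[OF filterlim_theta_modulus])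
    have 2: "((\<lambda>h. ellK (k h)) \<longlongrightarrow> pi / 2) at_top"
    proof -
      have "((\<lambda>h. pi / 2 * sech_sum h 0) \<longlongrightarrow> pi / 2 * 1) at_top"
        by (intro tendsto_intros tendsto_sech_sum_0)
      moreover have "eventually (\<lambda>h. pi / 2 * sech_sum h 0 = ellK (k h)) at_top"
        using eventually_gt_at_top[of 0] by eventually_elim (simp add: k_def ellK_theta_modulus)
      ultimately have "((\<lambda>h. ellK (k h)) \<longlongrightarrow> pi / 2 * 1) at_top" by (rule Lim_transform_eventually)
      thus ?thesis by simp
    qed
    \<comment> \<open>As \<open>ln (1 / k h) = h / 2 - ln (k h * exp (h / 2))\<close>, the limiting
      constant \<open>ln 4\<close> disappears after division by \<open>h\<close>.\<close>
    have "((\<lambda>h. 1 / 2 - ln (k h * exp (h / 2)) * (1 / h)) \<longlongrightarrow> 1 / 2 - ln 4 * 0) at_top"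
      unfolding k_def by (intro tendsto_intros tendsto_theta_modulus_scaled) (simp, real_asymp)
    moreover have "eventually (\<lambda>h. 1 / 2 - ln (k h * exp (h / 2)) * (1 / h) = ln (1 / k h) / h) at_top"
      using eventually_gt_at_top[of 0]
    proof eventually_elim
      case (elim h)
      have "k h > 0" using elim by (simp add: k_def theta_modulus_pos)
      thus ?case using elim by (simp add: ln_mult ln_div field_simps)
    qed
    ultimately have "((\<lambda>h. ln (1 / k h) / h) \<longlongrightarrow> 1 / 2 - ln 4 * 0) at_top"
      by (rule Lim_transform_eventually)
    hence 3: "((\<lambda>h. ln (1 / k h) / h) \<longlongrightarrow> 1 / 2) at_top" by simp
    have "((\<lambda>h. ellK (sqrt (1 - (k h)\<^sup>2)) / ln (1 / k h) * (ln (1 / k h) / h) / ellK (k h)) \<longlongrightarrow> 1 * (1 / 2) / (pi / 2)) at_top"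
      by (intro tendsto_intros 1 2 3) auto
    moreover have "eventually (\<lambda>h. ellK (sqrt (1 - (k h)\<^sup>2)) / ln (1 / k h) * (ln (1 / k h) / h) / ellK (k h)
        = period_ratio (k h) / h) at_top"
      using eventually_gt_at_top[of 0]
    proof eventually_elim
      case (elim h)
      have "ln (1 / k h) > 0" using elim
        by (intro ln_gt_zero) (simp add: k_def theta_modulus_pos theta_modulus_less_1)
      thus ?case by (simp add: period_ratio_def)
    qed
    ultimately have "((\<lambda>h. period_ratio (k h) / h) \<longlongrightarrow> 1 * (1 / 2) / (pi / 2)) at_top"
      by (rule Lim_transform_eventually)
    thus "((\<lambda>h. period_ratio (theta_modulus h) / h) \<longlongrightarrow> 1 / pi) at_top" by (simp add: k_def)
  qed
  thus ?thesis using assms by (simp add: field_simps)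
qed

text \<open>At \<open>h = pi * sqrt r\<close> the period ratio \<open>h / pi\<close> is
  \<open>sqrt r\<close>, so the defining equation of the singular modulus has an explicit
  solution.\<close>

lemma singular_modulus_eq:
  assumes "r > 0"
  shows "singular_modulus r = theta_modulus (pi * sqrt r)"
  using assms
  by (intro singular_modulus_eqI theta_modulus_pos theta_modulus_less_1)
     (auto simp: period_ratio_theta_modulus)

theorem theorem5p2:
  fixes r q :: real
  assumes "r > 0" and "q = exp (- pi * sqrt r)"
  shows "convergent (Q_approx q)
    \<and> Q_cf q = 1 / pi * ellK (singular_modulus (4 * r)) * sqrt (singular_modulus (4 * r))
    \<and> 1 / pi * ellK (singular_modulus (4 * r)) * sqrt (singular_modulus (4 * r))
        = 1 / (2 * pi) * ellK (singular_modulus r) * singular_modulus r"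
proof -
  define h where "h = pi * sqrt r"
  have h: "h > 0" using assms by (simp add: h_def)
  have q: "q = exp (- h)" "0 < q" "q < 1" using h by (auto simp: assms h_def)
  \<comment> \<open>All three expressions are shown to equal
    \<open>sech_sum h (1 / 2) / 4\<close>.\<close>
  have lim: "Q_approx q \<longlonglongrightarrow> sech_sum h (1 / 2) / 4"
    using Q_approx_tendsto[OF q(2,3)] sech_sum_half_lamb[OF h] by (simp add: q(1))
  have k1: "singular_modulus r = theta_modulus h"
    using singular_modulus_eq[OF assms(1)] by (simp add: h_def)
  \<comment> \<open>Replacing \<open>r\<close> by \<open>4 * r\<close> doubles \<open>h\<close>, so
    the two singular moduli are joined by one Landen step.\<close>
  have k4: "singular_modulus (4 * r) = theta_modulus (2 * h)"
    using singular_modulus_eq[of "4 * r"] assms by (simp add: h_def real_sqrt_mult mult_ac)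
  have "1 / (2 * pi) * ellK (theta_modulus h) * theta_modulus h = sech_sum h (1 / 2) / 4"
    unfolding ellK_theta_modulus[OF h] unfolding theta_modulus_def
    using sech_sum_0_pos[OF h] by simp
  moreover have "1 / pi * ellK (theta_modulus (2 * h)) * sqrt (theta_modulus (2 * h)) = sech_sum h (1 / 2) / 4"
  proof -
    have "ellK (theta_modulus (2 * h)) = pi / 2 * sech_sum (2 * h) 0"
      using h by (intro ellK_theta_modulus) simp
    thus ?thesis unfolding theta_modulus_landen(3)[OF h] by (simp only:) simp
  qed
  moreover have "convergent (Q_approx q)" "Q_cf q = sech_sum h (1 / 2) / 4"
    using lim by (auto simp: Q_cf_def limI convergentI)
  ultimately show ?thesis unfolding k1 k4 by (simp only: simp_thms)
qed

end
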